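(* Let $(\beta_n)_{n \in \mathbb{N}}$ be a sequence of positive numbers with $\lim_{n \to \infty} n^{-1/3} \beta_n = \infty$. Then, for all nonempty open sets $\mathcal{U} \subseteq \mathcal{P}$ and for all sequences of estimators $\hat{a}_n : \Omega^n \to \mathbb{R}$, $n \in \mathbb{N}$, one has $$\sup_{P \in \mathcal{U}} \limsup_{n \to \infty} P^n\big[\beta_n |\hat{a}_n - a(P)| > 1\big] \geq 1/4.$$
   Context: Let $\Omega = [0,1] \times \{\pm 1\}$ with the Borel $\sigma$-field. Let $\tilde{\mathcal{P}}$ be the set of all probability measures $P$ on $\Omega$ having a density $f_P \in C^1([0,1]\times\{\pm 1\})$ with respect to (Lebesgue measure on $[0,1]$) $\otimes$ (counting measure on $\{\pm1\}$). Write $f_P^+ := f_P(\cdot,1)$ and $f_P^- := f_P(\cdot,-1)$. Endow $\tilde{\mathcal{P}}$ with the metric $d(P,Q) := \|f_P - f_Q\|_\infty + \|\partial_1 f_P - \partial_1 f_Q\|_\infty$, where $\partial_1$ is the derivative with respect to the first argument. Let $\mathcal{P} \subseteq \tilde{\mathcal{P}}$ be the set of all $P \in \tilde{\mathcal{P}}$ such that there is a unique point $a(P) \in [0,1]$ with $f_P^+(a(P)) = f_P^-(a(P))$, this point lies in the open interval $(0,1)$, and $(f_P^+)'(a(P)) > (f_P^-)'(a(P))$. $\mathcal{P}$ carries the topology induced by $d$; "open" means open in $\mathcal{P}$. $P^n$ denotes the $n$-fold product measure of $P$ on $\Omega^n$. An estimator is a measurable function $\hat a_n:\Omega^n \to \mathbb{R}$.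 *)

theory Defs
  imports "HOL-Probability.Probability"
begin

definition Omega :: "(real \<times> int) set" where
  "Omega = {0..1} \<times> {-1, 1}"

definition Omega_borel :: "(real \<times> int) measure" where
  "Omega_borel = restrict_space borel Omega"

text \<open>The measure part of \<open>Omega_borel\<close> is never used, only its measurable structure. The
  dominating measure below lives on the same measurable space (see \<open>sets_dom_measure\<close>).\<close>

definition dom_measure :: "(real \<times> int) measure" where
  "dom_measure = restrict_space lborel {0..1} \<Otimes>\<^sub>M count_space {-1, 1}"

text \<open>Derivative with respect to the first argument, one-sided at the end points of the unit
  interval.\<close>

definition partial1 :: "(real \<times> int \<Rightarrow> real) \<Rightarrow> real \<times> int \<Rightarrow> real" where
  "partial1 f = (\<lambda>(x, y). vector_derivative (\<lambda>t. f (t, y)) (at x within {0..1}))"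

definition C1_Omega :: "(real \<times> int \<Rightarrow> real) \<Rightarrow> bool" where
  "C1_Omega f \<longleftrightarrow> (\<forall>y\<in>{-1, 1}.
     (\<lambda>t. f (t, y)) differentiable_on {0..1} \<and> continuous_on {0..1} (\<lambda>x. partial1 f (x, y)))"

definition C1_density :: "(real \<times> int) measure \<Rightarrow> (real \<times> int \<Rightarrow> real) \<Rightarrow> bool" where
  "C1_density P f \<longleftrightarrow>
     C1_Omega f \<and> (\<forall>\<omega>\<in>Omega. 0 \<le> f \<omega>) \<and> P = density dom_measure (\<lambda>\<omega>. ennreal (f \<omega>))"

definition P_tilde :: "(real \<times> int) measure set" where
  "P_tilde = {P. prob_space P \<and> (\<exists>f. C1_density P f)}"

text \<open>The choice below is unique on \<open>Omega\<close> (see \<open>C1_density_unique\<close>), and only the values on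
  \<open>Omega\<close> are ever used.\<close>

definition dens :: "(real \<times> int) measure \<Rightarrow> real \<times> int \<Rightarrow> real" where
  "dens P = (SOME f. C1_density P f)"

definition sup_norm :: "(real \<times> int \<Rightarrow> real) \<Rightarrow> real" where
  "sup_norm h = (SUP \<omega>\<in>Omega. \<bar>h \<omega>\<bar>)"

text \<open>Outside \<open>P_tilde\<close> the value \<open>0\<close> is a convention: the locale \<open>Metric_space\<close> requires
  nonnegativity and symmetry on the whole type.\<close>

definition P_dist :: "(real \<times> int) measure \<Rightarrow> (real \<times> int) measure \<Rightarrow> real" where
  "P_dist P Q = (if P \<in> P_tilde \<and> Q \<in> P_tilde
     then sup_norm (\<lambda>\<omega>. dens P \<omega> - dens Q \<omega>)
        + sup_norm (\<lambda>\<omega>. partial1 (dens P) \<omega> - partial1 (dens Q) \<omega>)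
     else 0)"

definition is_crossing :: "(real \<times> int) measure \<Rightarrow> real \<Rightarrow> bool" where
  "is_crossing P x \<longleftrightarrow> x \<in> {0..1} \<and> dens P (x, 1) = dens P (x, -1)"

definition crossing :: "(real \<times> int) measure \<Rightarrow> real" where
  "crossing P = (THE x. is_crossing P x)"

definition P_cal :: "(real \<times> int) measure set" where
  "P_cal = {P \<in> P_tilde. (\<exists>!x. is_crossing P x) \<and> crossing P \<in> {0<..<1} \<and>
     partial1 (dens P) (crossing P, 1) > partial1 (dens P) (crossing P, -1)}"

definition P_cal_topology :: "(real \<times> int) measure topology" where
  "P_cal_topology = subtopology (Metric_space.mtopology P_tilde P_dist) P_cal"


subsection \<open>Well-definedness\<close>

lemma space_dom_measure: "space dom_measure = Omega"
  by (simp add: dom_measure_def Omega_def space_pair_measure space_restrict_space)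

lemma sets_dom_measure: "sets dom_measure = sets Omega_borel"
proof
  have sp: "space Omega_borel = Omega"
    by (simp add: Omega_borel_def space_restrict_space)
  have fst0: "fst \<in> Omega_borel \<rightarrow>\<^sub>M borel" and snd0: "snd \<in> Omega_borel \<rightarrow>\<^sub>M borel"
    unfolding Omega_borel_def
    by (auto intro!: measurable_restrict_space1 borel_measurable_continuous_onI continuous_intros)
  have f: "fst \<in> Omega_borel \<rightarrow>\<^sub>M restrict_space lborel {0..1}"
    by (rule measurable_restrict_space2) (use fst0 in \<open>auto simp: sp Omega_def\<close>)
  have s: "snd \<in> Omega_borel \<rightarrow>\<^sub>M count_space {-1, 1}"
    unfolding measurable_count_space_eq2[of "{-1, 1::int}", simplified]
    by (auto simp: sp Omega_def intro!: measurable_sets[OF snd0, unfolded sp Omega_def])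
  have "(\<lambda>p. (fst p, snd p)) \<in> Omega_borel \<rightarrow>\<^sub>M dom_measure"
    unfolding dom_measure_def by (rule measurable_Pair[OF f s])
  hence id1: "(\<lambda>p. p) \<in> Omega_borel \<rightarrow>\<^sub>M dom_measure" by simp
  show "sets dom_measure \<subseteq> sets Omega_borel"
  proof
    fix A assume A: "A \<in> sets dom_measure"
    hence "A \<subseteq> Omega" using sets.sets_into_space space_dom_measure by metis
    thus "A \<in> sets Omega_borel"
      using measurable_sets[OF id1 A] by (simp add: sp Int_absorb2)
  qed
  have f': "fst \<in> dom_measure \<rightarrow>\<^sub>M borel"
    unfolding dom_measure_def
    by (rule measurable_compose[OF measurable_fst]) (auto intro!: measurable_restrict_space1)
  have s': "snd \<in> dom_measure \<rightarrow>\<^sub>M borel"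
    unfolding dom_measure_def
    by (rule measurable_compose[OF measurable_snd]) simp
  have "(\<lambda>p. p) \<in> dom_measure \<rightarrow>\<^sub>M borel"
  proof (rule borel_measurableI)
    fix S :: "(real \<times> int) set" assume S: "open S"
    let ?L = "\<lambda>k. (\<lambda>x. (x, k)) -` S"
    have "open (?L k)" for k
      by (rule open_vimage[OF S]) (intro continuous_intros)
    hence 1: "fst -` ?L k \<inter> space dom_measure \<in> sets dom_measure" for k
      by (intro measurable_sets[OF f'] borel_open)
    have 2: "snd -` {k} \<inter> space dom_measure \<in> sets dom_measure" for k
      by (intro measurable_sets[OF s']) simp
    have 3: "(\<lambda>p. p) -` S \<inter> space dom_measure
        = (\<Union>k\<in>{-1, 1}. (fst -` ?L k \<inter> space dom_measure) \<inter> (snd -` {k} \<inter> space dom_measure))"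
      by (auto simp: space_dom_measure Omega_def)
    show "(\<lambda>p. p) -` S \<inter> space dom_measure \<in> sets dom_measure"
      unfolding 3 by (rule sets.finite_UN) (use 1 2 in \<open>blast intro: sets.Int\<close>)+
  qed
  hence id2: "(\<lambda>p. p) \<in> dom_measure \<rightarrow>\<^sub>M Omega_borel"
    unfolding Omega_borel_def
    by (intro measurable_restrict_space2) (auto simp: space_dom_measure)
  show "sets Omega_borel \<subseteq> sets dom_measure"
  proof
    fix A assume A: "A \<in> sets Omega_borel"
    hence "A \<subseteq> Omega" using sets.sets_into_space sp by metis
    thus "A \<in> sets dom_measure"
      using measurable_sets[OF id2 A] by (simp add: space_dom_measure Int_absorb2)
  qed
qed

lemma C1_Omega_cont:
  assumes "C1_Omega f" "y \<in> {-1, 1}"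
  shows "continuous_on {0..1} (\<lambda>x. f (x, y))"
  using assms by (auto simp: C1_Omega_def intro: differentiable_imp_continuous_on)

lemma C1_Omega_measurable:
  assumes "C1_Omega f"
  shows "f \<in> borel_measurable dom_measure"
proof -
  let ?R = "restrict_space lborel {0..1::real}"
  have *: "(\<lambda>x. f (x, y)) \<in> borel_measurable ?R" if "y \<in> {-1, 1}" for y
  proof -
    have "(\<lambda>x. f (x, y)) \<in> borel_measurable (restrict_space borel {0..1})"
      by (rule borel_measurable_continuous_on_restrict[OF C1_Omega_cont[OF assms that]])
    thus ?thesis
      by (simp add: measurable_def space_restrict_space sets_restrict_space)
  qed
  have "(\<lambda>p. if snd p = 1 then f (fst p, 1) else f (fst p, -1)) \<in> borel_measurable dom_measure"
    unfolding dom_measure_def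
    by (intro measurable_If measurable_compose[OF measurable_fst *]) measurable
  thus ?thesis
    by (rule measurable_cong[THEN iffD1, rotated]) (auto simp: space_dom_measure Omega_def)
qed

lemma C1_density_unique:
  assumes "prob_space P" "C1_density P f" "C1_density P g" "\<omega> \<in> Omega"
  shows "f \<omega> = g \<omega>"
proof -
  let ?R = "restrict_space lborel {0..1::real}"
  interpret P: prob_space P by fact
  have C: "C1_Omega f" "C1_Omega g" using assms by (auto simp: C1_density_def)
  note m[measurable] = C1_Omega_measurable[OF C(1)] C1_Omega_measurable[OF C(2)]
  have pos: "\<And>\<omega>. \<omega> \<in> Omega \<Longrightarrow> 0 \<le> f \<omega>" "\<And>\<omega>. \<omega> \<in> Omega \<Longrightarrow> 0 \<le> g \<omega>"
    using assms by (auto simp: C1_density_def)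
  have Pf: "P = density dom_measure (\<lambda>\<omega>. ennreal (f \<omega>))"
    and Pg: "P = density dom_measure (\<lambda>\<omega>. ennreal (g \<omega>))"
    using assms by (auto simp: C1_density_def)
  have sf: "sigma_finite_measure P" by unfold_locales
  have "AE z in dom_measure. ennreal (f z) = ennreal (g z)"
    using sigma_finite_density_unique[of "\<lambda>\<omega>. ennreal (f \<omega>)" dom_measure "\<lambda>\<omega>. ennreal (g \<omega>)"]
      sf Pf Pg by simp
  hence AE: "AE z in dom_measure. f z = g z"
    by (rule AE_mp) (intro AE_I2 impI, simp add: space_dom_measure pos)
  interpret R: finite_measure ?R
    by (rule finite_measureI) (simp add: emeasure_restrict_space space_restrict_space)
  interpret S: finite_measure "count_space {-1, 1::int}"
    by (rule finite_measure_count_space) simp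
  interpret PS: pair_sigma_finite ?R "count_space {-1, 1::int}" ..
  obtain x y where xy: "\<omega> = (x, y)" "x \<in> {0..1}" "y \<in> {-1, 1}"
    using assms(4) by (auto simp: Omega_def)
  have "AE x in ?R. AE y in count_space {-1, 1}. f (x, y) = g (x, y)"
    by (rule PS.AE_pair[OF AE[unfolded dom_measure_def]])
  hence "AE x in ?R. f (x, y) = g (x, y)"
    by (rule AE_mp) (intro AE_I2 impI, use xy in \<open>auto simp: AE_count_space\<close>)
  hence AEl: "AE x in lborel. x \<in> {0..1} \<longrightarrow> f (x, y) = g (x, y)"
    by (simp add: AE_restrict_space_iff)
  let ?C = "{x \<in> {0..1}. f (x, y) - g (x, y) = 0}"
  have cont: "continuous_on {0..1} (\<lambda>x. f (x, y) - g (x, y))"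
    using C xy by (intro continuous_intros C1_Omega_cont) auto
  have cl: "closed ?C"
    using continuous_closed_preimage_constant[OF cont, of 0] by simp
  have "{0<..<1} \<subseteq> ?C"
  proof
    fix t :: real assume t: "t \<in> {0<..<1}"
    have "AE x \<in> {0<..<1} in lebesgue. x \<in> ?C"
      by (rule AE_completion) (use AEl in \<open>rule AE_mp\<close>, intro AE_I2, auto)
    from mem_closed_if_AE_lebesgue_open[OF _ cl this t] show "t \<in> ?C" by simp
  qed
  hence "closure {0<..<1} \<subseteq> ?C" using cl by (rule closure_minimal)
  thus ?thesis using xy by auto
qed

lemma dens_C1:
  assumes "P \<in> P_tilde"
  shows "C1_density P (dens P)"
proof -
  have "\<exists>f. C1_density P f" using assms by (auto simp: P_tilde_def)
  thus ?thesis unfolding dens_def by (rule someI_ex)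
qed

lemma cont_bdd:
  fixes h :: "real \<times> int \<Rightarrow> real"
  assumes "\<And>y. y \<in> {-1, 1} \<Longrightarrow> continuous_on {0..1} (\<lambda>x. h (x, y))"
  shows "bdd_above ((\<lambda>\<omega>. \<bar>h \<omega>\<bar>) ` Omega)"
proof -
  have "bdd_above ((\<lambda>x. \<bar>h (x, y)\<bar>) ` {0..1})" if "y \<in> {-1, 1}" for y
    using compact_continuous_image[OF continuous_on_rabs[OF assms[OF that]] compact_Icc]
    by (auto dest!: compact_imp_bounded simp: bounded_imp_bdd_above)
  moreover have "(\<lambda>\<omega>. \<bar>h \<omega>\<bar>) ` Omega
      = (\<lambda>x. \<bar>h (x, -1)\<bar>) ` {0..1} \<union> (\<lambda>x. \<bar>h (x, 1)\<bar>) ` {0..1}"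
    by (auto simp: Omega_def)
  ultimately show ?thesis by simp
qed

lemma sup_norm_triangle:
  assumes "bdd_above ((\<lambda>\<omega>. \<bar>f \<omega> - g \<omega>\<bar>) ` Omega)" "bdd_above ((\<lambda>\<omega>. \<bar>g \<omega> - h \<omega>\<bar>) ` Omega)"
  shows "sup_norm (\<lambda>\<omega>. f \<omega> - h \<omega>) \<le> sup_norm (\<lambda>\<omega>. f \<omega> - g \<omega>) + sup_norm (\<lambda>\<omega>. g \<omega> - h \<omega>)"
  unfolding sup_norm_def
proof (rule cSUP_least)
  fix \<omega> assume \<omega>: "\<omega> \<in> Omega"
  show "\<bar>f \<omega> - h \<omega>\<bar> \<le> (SUP \<omega>\<in>Omega. \<bar>f \<omega> - g \<omega>\<bar>) + (SUP \<omega>\<in>Omega. \<bar>g \<omega> - h \<omega>\<bar>)"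
    using cSUP_upper[OF \<omega> assms(1)] cSUP_upper[OF \<omega> assms(2)] by linarith
qed (auto simp: Omega_def)

lemma sup_norm_nonneg:
  assumes "bdd_above ((\<lambda>\<omega>. \<bar>h \<omega>\<bar>) ` Omega)"
  shows "0 \<le> sup_norm h"
proof -
  have "(0, 1) \<in> Omega" by (auto simp: Omega_def)
  from cSUP_upper[OF this assms] show ?thesis unfolding sup_norm_def by linarith
qed

lemma Metric_space_P_tilde: "Metric_space P_tilde P_dist"
proof -
  have b0: "bdd_above ((\<lambda>\<omega>. \<bar>dens P \<omega> - dens Q \<omega>\<bar>) ` Omega)"
    if "P \<in> P_tilde" "Q \<in> P_tilde" for P Q
    using dens_C1[OF that(1)] dens_C1[OF that(2)]
    by (intro cont_bdd continuous_intros C1_Omega_cont) (auto simp: C1_density_def)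
  have b1: "bdd_above ((\<lambda>\<omega>. \<bar>partial1 (dens P) \<omega> - partial1 (dens Q) \<omega>\<bar>) ` Omega)"
    if "P \<in> P_tilde" "Q \<in> P_tilde" for P Q
    using dens_C1[OF that(1)] dens_C1[OF that(2)]
    by (intro cont_bdd continuous_intros) (auto simp: C1_density_def C1_Omega_def)
  have ne: "Omega \<noteq> {}" by (auto simp: Omega_def)
  show ?thesis
  proof
    fix P Q :: "(real \<times> int) measure"
    show "0 \<le> P_dist P Q"
      by (auto simp: P_dist_def intro!: add_nonneg_nonneg sup_norm_nonneg b0 b1)
    show "P_dist P Q = P_dist Q P"
      by (auto simp: P_dist_def sup_norm_def abs_minus_commute)
  next
    fix P Q assume PQ: "P \<in> P_tilde" "Q \<in> P_tilde"
    show "P_dist P Q = 0 \<longleftrightarrow> P = Q"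
    proof
      assume "P = Q"
      thus "P_dist P Q = 0" using ne by (simp add: P_dist_def sup_norm_def)
    next
      assume "P_dist P Q = 0"
      hence "sup_norm (\<lambda>\<omega>. dens P \<omega> - dens Q \<omega>) = 0"
        using PQ sup_norm_nonneg[OF b0[OF PQ]] sup_norm_nonneg[OF b1[OF PQ]]
        by (simp add: P_dist_def)
      hence eq: "dens P \<omega> = dens Q \<omega>" if "\<omega> \<in> Omega" for \<omega>
        using cSUP_upper[OF that b0[OF PQ]] by (simp add: sup_norm_def)
      have CP: "C1_density P (dens P)" and CQ: "C1_density Q (dens Q)"
        using PQ dens_C1 by auto
      have "density dom_measure (\<lambda>\<omega>. ennreal (dens P \<omega>))
          = density dom_measure (\<lambda>\<omega>. ennreal (dens Q \<omega>))"
        using CP CQ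
        by (intro density_cong AE_I2)
          (auto simp: space_dom_measure eq C1_density_def intro!: measurable_compose[OF C1_Omega_measurable])
      thus "P = Q" using CP CQ by (simp add: C1_density_def)
    qed
  next
    fix P Q R assume "P \<in> P_tilde" "Q \<in> P_tilde" "R \<in> P_tilde"
    thus "P_dist P R \<le> P_dist P Q + P_dist Q R"
      using sup_norm_triangle[OF b0 b0, of P Q R] sup_norm_triangle[OF b1 b1, of P Q R]
      by (simp add: P_dist_def)
  qed
qed

end

(* Densities are perturbed by y * H(x), where H is the antiderivative of a small continuous h; this
   keeps the mass fixed, so that a norm ball of such h parametrises a part of U by a complete metric
   space. If the supremum were below c < 1/4, the ball would be the union over m of the closed sets on
   which the deviation probability is at most c for all n > m, and by Baire's theorem one of them
   would have an interior point. At such a point, a bump of H at the crossing, of width and height of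
   order w = tau * n powr (-1/3), stays small in C1 and moves the crossing by order w, which
   exceeds 2 / beta n for large n. The chi-square distance of one observation is of order w^3, so
   for small tau the n-fold products differ by at most 1/2 in total variation. Since every value of
   the estimator is far from one of the two crossings, 1 <= c + (c + 1/2), a contradiction. *)

theory Submission
  imports Defs
begin

subsection \<open>Chi-square bound for product measures\<close>

text \<open>The limsup is taken for each measure separately, so a small supremum gives no index at
  which several measures obey the bound together; yet the two measures to be compared must depend on
  n. This obstacle calls for Baire's theorem: it yields a ball of fixed radius on which one
  threshold index serves all measures, and the ball leaves room for a bump at every later n. The
  exponent 1/3 comes from the C1 metric: a bump of bounded slope and width w has height of order w,
  and squared height times width is what one observation contributes. The chi-square distance
  divides by the density of the base measure, which may vanish for the given point of U, so the
  centre of the ball is first mixed with the uniform distribution. A bump of given height moves the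
  crossing far only if the difference of the two branches is not too steep, so a Lipschitz constant
  valid on the whole ball is needed. Closedness of the sets in Baire's theorem rests on the strict
  inequality in the deviation event, on continuity of the crossing and on continuity of the product
  measures in total variation.\<close>

lemma prob_space_density_iff:
  assumes "g \<in> borel_measurable M"
  shows "prob_space (density M g) \<longleftrightarrow> (\<integral>\<^sup>+x. g x \<partial>M) = 1"
proof -
  have "emeasure (density M g) (space M) = (\<integral>\<^sup>+x. g x \<partial>M)"
    using assms by (subst emeasure_density) (auto cong: nn_integral_cong simp: indicator_def)
  thus ?thesis by (auto intro!: prob_spaceI dest: prob_space.emeasure_space_1)
qed

text \<open>By Tonelli both sides give a rectangle the same product of integrals, and rectangles
  determine a product measure. Sigma-finiteness of the densities is assumed because
  \<open>f i\<close> may take the value infinity.\<close>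

lemma PiM_density:
  assumes fin: "finite I"
    and M: "\<And>i. sigma_finite_measure (M i)" "\<And>i. sigma_finite_measure (density (M i) (f i))"
    and f[measurable]: "\<And>i. f i \<in> borel_measurable (M i)"
  shows "Pi\<^sub>M I (\<lambda>i. density (M i) (f i)) = density (Pi\<^sub>M I M) (\<lambda>x. \<Prod>i\<in>I. f i (x i))"
proof -
  interpret product_sigma_finite M by (rule product_sigma_finite.intro) (rule M)
  interpret D: product_sigma_finite "\<lambda>i. density (M i) (f i)"
    by (rule product_sigma_finite.intro) (rule M)
  show ?thesis
  proof (rule D.PiM_eqI[symmetric, OF fin])
    show "sets (density (Pi\<^sub>M I M) (\<lambda>x. \<Prod>i\<in>I. f i (x i))) = sets (Pi\<^sub>M I (\<lambda>i. density (M i) (f i)))"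
      by (simp cong: sets_PiM_cong)
  next
    fix A assume "\<And>i. i \<in> I \<Longrightarrow> A i \<in> sets (density (M i) (f i))"
    hence A[measurable]: "\<And>i. i \<in> I \<Longrightarrow> A i \<in> sets (M i)" by simp
    have "emeasure (density (Pi\<^sub>M I M) (\<lambda>x. \<Prod>i\<in>I. f i (x i))) (Pi\<^sub>E I A)
        = (\<integral>\<^sup>+x. (\<Prod>i\<in>I. f i (x i)) * indicator (Pi\<^sub>E I A) x \<partial>Pi\<^sub>M I M)"
      by (rule emeasure_density) (use fin in \<open>measurable\<close>)
    also have "\<dots> = (\<integral>\<^sup>+x. (\<Prod>i\<in>I. f i (x i) * indicator (A i) (x i)) \<partial>Pi\<^sub>M I M)"
    proof (rule nn_integral_cong)
      fix x assume x: "x \<in> space (Pi\<^sub>M I M)"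
      have "indicator (Pi\<^sub>E I A) x = (\<Prod>i\<in>I. indicator (A i) (x i) :: ennreal)"
      proof (cases "x \<in> Pi\<^sub>E I A")
        case True
        hence "(\<Prod>i\<in>I. indicator (A i) (x i) :: ennreal) = (\<Prod>i\<in>I. 1)"
          by (intro prod.cong) (auto simp: PiE_iff)
        thus ?thesis using True by simp
      next
        case False
        then obtain i where "i \<in> I" "x i \<notin> A i"
          using x by (auto simp: space_PiM PiE_iff)
        thus ?thesis using False fin by (simp add: prod_zero_iff) (metis indicator_simps(2))
      qed
      thus "(\<Prod>i\<in>I. f i (x i)) * indicator (Pi\<^sub>E I A) x = (\<Prod>i\<in>I. f i (x i) * indicator (A i) (x i))"
        by (simp add: prod.distrib)
    qed
    also have "\<dots> = (\<Prod>i\<in>I. \<integral>\<^sup>+x. f i x * indicator (A i) x \<partial>M i)"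
      by (rule product_nn_integral_prod[OF fin]) simp
    also have "\<dots> = (\<Prod>i\<in>I. emeasure (density (M i) (f i)) (A i))"
      by (intro prod.cong refl emeasure_density[symmetric]) auto
    finally show "emeasure (density (Pi\<^sub>M I M) (\<lambda>x. \<Prod>i\<in>I. f i (x i))) (Pi\<^sub>E I A)
      = (\<Prod>i\<in>I. emeasure (density (M i) (f i)) (A i))" .
  qed
qed

text \<open>The likelihood ratio of the products is the product \<open>?R\<close> of the single
  ratios. It has mean 1, and its second moment is the power of the single second moment, which is 1
  plus the chi-square distance. The difference of the two probabilities is the integral of
  \<open>?R - 1\<close> over \<open>A\<close>, hence at most the standard deviation of
  \<open>?R\<close>.\<close>

lemma PiM_measure_diff_le_chi_square:
  fixes r :: "'a \<Rightarrow> real"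
  assumes fin: "finite I" and M: "prob_space M" and N: "prob_space (density M r)"
    and r[measurable]: "r \<in> borel_measurable M" and r0: "\<And>x. x \<in> space M \<Longrightarrow> 0 \<le> r x"
    and i2: "integrable M (\<lambda>x. (r x - 1)\<^sup>2)" and K: "(\<integral>x. (r x - 1)\<^sup>2 \<partial>M) \<le> K"
    and A[measurable]: "A \<in> sets (Pi\<^sub>M I (\<lambda>_. M))"
  shows "\<bar>measure (Pi\<^sub>M I (\<lambda>_. density M r)) A - measure (Pi\<^sub>M I (\<lambda>_. M)) A\<bar>
    \<le> sqrt ((1 + K) ^ card I - 1)"
proof -
  interpret M: prob_space M by fact
  interpret N: prob_space "density M r" by fact
  interpret P: product_sigma_finite "\<lambda>_. M"
    by (rule product_sigma_finite.intro) (rule M.sigma_finite_measure_axioms)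
  interpret P: prob_space "Pi\<^sub>M I (\<lambda>_. M)" by (rule prob_space_PiM) (rule M)
  let ?R = "\<lambda>x. \<Prod>i\<in>I. r (x i)"
  have n1: "(\<integral>\<^sup>+x. r x \<partial>M) = 1"
    using N prob_space_density_iff[of "\<lambda>x. ennreal (r x)" M] by simp
  have ir: "integrable M r"
    by (rule integrableI_nonneg) (auto simp: n1 r0 intro!: AE_I2)
  have r1: "(\<integral>x. r x \<partial>M) = 1"
    using n1 by (subst integral_eq_nn_integral) (auto intro!: AE_I2 r0)
  have r2eq: "(r x)\<^sup>2 = (r x - 1)\<^sup>2 + 2 * r x - 1" for x by (simp add: power2_eq_square algebra_simps)
  have ir2: "integrable M (\<lambda>x. (r x)\<^sup>2)" unfolding r2eq using i2 ir by simp
  have "(\<integral>x. (r x)\<^sup>2 \<partial>M) = (\<integral>x. (r x - 1)\<^sup>2 \<partial>M) + 1"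
    unfolding r2eq using i2 ir by (simp add: r1 M.prob_space)
  hence r2: "(\<integral>x. (r x)\<^sup>2 \<partial>M) \<le> 1 + K" using K by simp
  have iR: "integrable (Pi\<^sub>M I (\<lambda>_. M)) ?R"
    by (rule P.product_integrable_prod[OF fin]) (rule ir)
  have eR: "(\<integral>x. ?R x \<partial>Pi\<^sub>M I (\<lambda>_. M)) = 1"
    by (subst P.product_integral_prod[OF fin ir]) (simp add: r1)
  have iR2: "integrable (Pi\<^sub>M I (\<lambda>_. M)) (\<lambda>x. (?R x)\<^sup>2)"
    unfolding prod_power_distrib by (rule P.product_integrable_prod[OF fin]) (rule ir2)
  have eR2: "(\<integral>x. (?R x)\<^sup>2 \<partial>Pi\<^sub>M I (\<lambda>_. M)) \<le> (1 + K) ^ card I"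
    unfolding prod_power_distrib
    by (subst P.product_integral_prod[OF fin ir2]) (auto intro!: power_mono r2)
  have R0: "0 \<le> ?R x" if "x \<in> space (Pi\<^sub>M I (\<lambda>_. M))" for x
    using that by (intro prod_nonneg) (auto simp: space_PiM intro: r0)
  have "Pi\<^sub>M I (\<lambda>_. density M r) = density (Pi\<^sub>M I (\<lambda>_. M)) (\<lambda>x. \<Prod>i\<in>I. ennreal (r (x i)))"
    by (rule PiM_density[OF fin]) (auto intro: M.sigma_finite_measure_axioms N.sigma_finite_measure_axioms)
  also have "\<dots> = density (Pi\<^sub>M I (\<lambda>_. M)) (\<lambda>x. ennreal (?R x))"
    by (rule density_cong) (use fin in \<open>auto intro!: AE_I2 prod_ennreal simp: space_PiM r0 PiE_iff\<close>)
  finally have eq: "Pi\<^sub>M I (\<lambda>_. density M r) = density (Pi\<^sub>M I (\<lambda>_. M)) (\<lambda>x. ennreal (?R x))" .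
  have "measure (Pi\<^sub>M I (\<lambda>_. density M r)) A = (\<integral>x. ?R x * indicator A x \<partial>Pi\<^sub>M I (\<lambda>_. M))"
  proof -
    have A': "A \<in> sets (density (Pi\<^sub>M I (\<lambda>_. M)) ?R)" using A by simp
    have "measure (density (Pi\<^sub>M I (\<lambda>_. M)) ?R) A
        = (\<integral>x. indicator A x \<partial>density (Pi\<^sub>M I (\<lambda>_. M)) ?R)"
      using sets.sets_into_space[OF A'] by (simp add: Int_absorb2)
    also have "\<dots> = (\<integral>x. ?R x * indicator A x \<partial>Pi\<^sub>M I (\<lambda>_. M))"
      using fin R0 by (subst integral_density) (auto intro!: AE_I2)
    finally show ?thesis by (simp only: eq)
  qed
  moreover have "measure (Pi\<^sub>M I (\<lambda>_. M)) A = (\<integral>x. indicator A x \<partial>Pi\<^sub>M I (\<lambda>_. M))"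
    using sets.sets_into_space[OF A] by (simp add: Int_absorb2)
  moreover have iRA: "integrable (Pi\<^sub>M I (\<lambda>_. M)) (\<lambda>x. ?R x * indicator A x)"
    by (rule integrable_real_mult_indicator[OF A iR])
  ultimately have d: "measure (Pi\<^sub>M I (\<lambda>_. density M r)) A - measure (Pi\<^sub>M I (\<lambda>_. M)) A
      = (\<integral>x. (?R x - 1) * indicator A x \<partial>Pi\<^sub>M I (\<lambda>_. M))" (is "?d = (\<integral>x. ?Y x \<partial>_)")
    by (simp add: left_diff_distrib less_top[symmetric])
  have i3: "integrable (Pi\<^sub>M I (\<lambda>_. M)) (\<lambda>x. (?R x - 1)\<^sup>2)"
    using iR iR2 by (simp add: power2_diff)
  have iY: "integrable (Pi\<^sub>M I (\<lambda>_. M)) ?Y"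
    using iRA by (simp add: left_diff_distrib less_top[symmetric])
  have iY2: "integrable (Pi\<^sub>M I (\<lambda>_. M)) (\<lambda>x. (?Y x)\<^sup>2)"
    by (rule Bochner_Integration.integrable_bound[OF i3])
      (auto simp: power_mult_distrib indicator_def intro!: AE_I2)
  \<comment> \<open>Cauchy-Schwarz on a probability space, in the form that the variance of
    \<open>?Y\<close> is nonnegative.\<close>
  have "?d\<^sup>2 \<le> (\<integral>x. (?Y x)\<^sup>2 \<partial>Pi\<^sub>M I (\<lambda>_. M))"
    unfolding d using P.variance_eq[OF iY iY2] P.variance_positive[of ?Y] by simp
  also have "\<dots> \<le> (\<integral>x. (?R x - 1)\<^sup>2 \<partial>Pi\<^sub>M I (\<lambda>_. M))"
    by (rule integral_mono[OF iY2 i3]) (auto simp: power_mult_distrib indicator_def)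
  also have "\<dots> = (\<integral>x. (?R x)\<^sup>2 \<partial>Pi\<^sub>M I (\<lambda>_. M)) - 1"
    using iR iR2 by (simp add: power2_diff eR P.prob_space)
  also have "\<dots> \<le> (1 + K) ^ card I - 1" using eR2 by simp
  finally show ?thesis by (rule real_le_rsqrt[of "\<bar>_\<bar>", simplified])
qed

text \<open>Relative to \<open>density \<mu> p\<close> the likelihood ratio is q / p, and its
  chi-square distance is the integral of (q - p)^2 / p. A lower bound on \<open>p\<close> alone
  controls the denominator; \<open>q\<close> may vanish.\<close>

lemma PiM_density_measure_diff_le:
  fixes p q :: "'a \<Rightarrow> real"
  assumes fin: "finite I" and \<mu>: "finite_measure \<mu>"
    and P: "prob_space (density \<mu> p)" and Q: "prob_space (density \<mu> q)"
    and m[measurable]: "p \<in> borel_measurable \<mu>" "q \<in> borel_measurable \<mu>"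
    and p0: "0 < p0" "\<And>x. x \<in> space \<mu> \<Longrightarrow> p0 \<le> p x"
    and q0: "\<And>x. x \<in> space \<mu> \<Longrightarrow> 0 \<le> q x"
    and E[measurable]: "E \<in> sets \<mu>"
    and s: "\<And>x. x \<in> space \<mu> \<Longrightarrow> \<bar>q x - p x\<bar> \<le> s * indicator E x"
    and A: "A \<in> sets (Pi\<^sub>M I (\<lambda>_. \<mu>))"
  shows "\<bar>measure (Pi\<^sub>M I (\<lambda>_. density \<mu> q)) A - measure (Pi\<^sub>M I (\<lambda>_. density \<mu> p)) A\<bar>
    \<le> sqrt ((1 + s\<^sup>2 / p0 * measure \<mu> E) ^ card I - 1)"
proof -
  interpret \<mu>: finite_measure \<mu> by fact
  let ?r = "\<lambda>x. q x / p x"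
  have pp: "0 < p x" if "x \<in> space \<mu>" for x using p0 that by fastforce
  have eq: "density (density \<mu> p) ?r = density \<mu> q"
    by (subst density_density_eq)
      (auto intro!: density_cong AE_I2 simp: ennreal_mult'[symmetric] pp less_imp_le dest: pp)
  have le: "p x * (?r x - 1)\<^sup>2 \<le> s\<^sup>2 / p0 * indicator E x" if x: "x \<in> space \<mu>" for x
  proof -
    have "p x * (?r x - 1)\<^sup>2 = (q x - p x)\<^sup>2 / p x"
      using pp[OF x] by (simp add: field_simps power2_eq_square)
    also have "\<dots> \<le> (q x - p x)\<^sup>2 / p0"
      using p0(1) p0(2)[OF x] by (intro divide_left_mono) auto
    also have "\<dots> \<le> (s * indicator E x)\<^sup>2 / p0"
      using s[OF x] p0(1) by (intro divide_right_mono) (auto simp: abs_le_square_iff[symmetric])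
    finally show ?thesis by (auto simp: indicator_def)
  qed
  have iE: "integrable \<mu> (\<lambda>x. s\<^sup>2 / p0 * indicator E x :: real)"
    by (simp add: less_top[symmetric])
  have i: "integrable \<mu> (\<lambda>x. p x * (?r x - 1)\<^sup>2)"
  proof (rule Bochner_Integration.integrable_bound[OF iE])
    show "AE x in \<mu>. norm (p x * (?r x - 1)\<^sup>2) \<le> norm (s\<^sup>2 / p0 * indicator E x :: real)"
    proof (rule AE_I2)
      fix x assume x: "x \<in> space \<mu>"
      have "norm (p x * (?r x - 1)\<^sup>2) = p x * (?r x - 1)\<^sup>2" using pp[OF x] by simp
      thus "norm (p x * (?r x - 1)\<^sup>2) \<le> norm (s\<^sup>2 / p0 * indicator E x :: real)"
        using le[OF x] by (metis abs_ge_self order_trans real_norm_def)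
    qed
  qed simp
  have nn: "AE x in \<mu>. 0 \<le> p x" by (auto intro!: AE_I2 less_imp_le pp)
  have "\<bar>measure (Pi\<^sub>M I (\<lambda>_. density (density \<mu> p) ?r)) A - measure (Pi\<^sub>M I (\<lambda>_. density \<mu> p)) A\<bar>
    \<le> sqrt ((1 + s\<^sup>2 / p0 * measure \<mu> E) ^ card I - 1)"
  proof (rule PiM_measure_diff_le_chi_square[OF fin P])
    show "prob_space (density (density \<mu> p) ?r)" using Q eq by simp
    show "0 \<le> ?r x" if "x \<in> space (density \<mu> p)" for x
      using that q0[of x] pp[of x] by simp
    show "integrable (density \<mu> p) (\<lambda>x. (?r x - 1)\<^sup>2)"
      using i by (subst integrable_density[OF _ _ nn]) auto
    have "(\<integral>x. (?r x - 1)\<^sup>2 \<partial>density \<mu> p) = (\<integral>x. p x * (?r x - 1)\<^sup>2 \<partial>\<mu>)"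
      by (subst integral_density[OF _ _ nn]) auto
    also have "\<dots> \<le> (\<integral>x. s\<^sup>2 / p0 * indicator E x \<partial>\<mu>)"
      by (rule integral_mono[OF i iE]) (rule le)
    also have "\<dots> = s\<^sup>2 / p0 * measure \<mu> E"
      using sets.sets_into_space[OF E] by (simp add: Int_absorb2)
    finally show "(\<integral>x. (?r x - 1)\<^sup>2 \<partial>density \<mu> p) \<le> s\<^sup>2 / p0 * measure \<mu> E" .
    show "A \<in> sets (Pi\<^sub>M I (\<lambda>_. density \<mu> p))"
      using A by (simp cong: sets_PiM_cong)
  qed simp
  thus ?thesis by (simp add: eq)
qed

subsection \<open>Stability of zeros, bumps and antiderivatives\<close>

lemma derivative_lower_bound_imp_growth:
  fixes G G' :: "real \<Rightarrow> real"
  assumes der: "\<And>x. x \<in> S \<Longrightarrow> (G has_real_derivative G' x) (at x within S)"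
    and sub: "{x..y} \<subseteq> S" and xy: "x \<le> y" and c: "\<And>z. z \<in> {x..y} \<Longrightarrow> c \<le> G' z"
  shows "c * (y - x) \<le> G y - G x"
proof -
  have "\<exists>z\<in>{x..y}. G y - G x = G' z * (y - x)"
    by (rule mvt_very_simple[OF xy])
      (use sub in \<open>auto intro!: has_derivative_subset[OF der[THEN has_field_derivative_imp_has_derivative]]\<close>)
  then obtain z where "z \<in> {x..y}" "G y - G x = G' z * (y - x)" by blast
  thus ?thesis using c[of z] xy by (simp add: mult_right_mono)
qed

text \<open>Near \<open>a0\<close> the slope of \<open>g\<close> is at least half its value at
  \<open>a0\<close>; away from \<open>a0\<close> compactness keeps \<bar>g\<bar> above a positive
  constant. A \<open>\<delta>\<close> of at most half of either bound survives a C1 perturbation of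
  size \<open>\<delta>\<close>. The linear growth in the conclusion gives both uniqueness of the
  zero and its Lipschitz dependence on \<open>G\<close>.\<close>

lemma stable_zero:
  fixes g g' :: "real \<Rightarrow> real"
  assumes der: "\<And>x. x \<in> {0..1} \<Longrightarrow> (g has_real_derivative g' x) (at x within {0..1})"
    and cont: "continuous_on {0..1} g'"
    and a0: "a0 \<in> {0<..<1}" "g a0 = 0" "\<And>x. x \<in> {0..1} \<Longrightarrow> g x = 0 \<Longrightarrow> x = a0"
    and pos: "0 < g' a0"
  shows "\<exists>\<delta>>0. \<forall>G G'. (\<forall>x\<in>{0..1}. (G has_real_derivative G' x) (at x within {0..1}) \<and>
        \<bar>G x - g x\<bar> \<le> \<delta> \<and> \<bar>G' x - g' x\<bar> \<le> \<delta>) \<longrightarrow>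
      (\<exists>a\<in>{0<..<1}. G a = 0 \<and> 0 < G' a \<and> (\<forall>x\<in>{0..1}. \<delta> * \<bar>x - a\<bar> \<le> \<bar>G x\<bar>))"
proof -
  define m where "m = g' a0 / 2"
  have m: "0 < m" using pos by (simp add: m_def)
  have "continuous (at a0 within {0..1}) g'"
    using cont a0(1) by (simp add: continuous_on_eq_continuous_within)
  then obtain \<eta>0 where \<eta>0: "0 < \<eta>0" "\<And>x. x \<in> {0..1} \<Longrightarrow> \<bar>x - a0\<bar> < \<eta>0 \<Longrightarrow> \<bar>g' x - g' a0\<bar> < m"
    using m unfolding continuous_within_eps_delta dist_real_def by blast
  \<comment> \<open>The halves keep the closed interval from \<open>l\<close> to \<open>u\<close>
    strictly inside both the neighbourhood of radius \<open>\<eta>0\<close> and the open unit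
    interval.\<close>
  define \<eta> where "\<eta> = min (\<eta>0 / 2) (min (a0 / 2) ((1 - a0) / 2))"
  define l where "l = a0 - \<eta>"
  define u where "u = a0 + \<eta>"
  have \<eta>: "0 < \<eta>" "\<eta> < \<eta>0" "\<eta> \<le> a0 / 2" "\<eta> \<le> (1 - a0) / 2" using \<eta>0(1) a0(1) by (auto simp: \<eta>_def min_def)
  have lu: "0 < l" "l < a0" "a0 < u" "u < 1" using \<eta> a0(1) by (auto simp: l_def u_def)
  have g'm: "m \<le> g' x" if "x \<in> {l..u}" for x
  proof -
    have "x \<in> {0..1}" "\<bar>x - a0\<bar> < \<eta>0" using that lu \<eta> by (auto simp: l_def u_def)
    from \<eta>0(2)[OF this] show ?thesis unfolding m_def by linarith
  qed
  have contg: "continuous_on {0..1} g" using der by (rule DERIV_continuous_on)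
  have sub: "{x..y} \<subseteq> {0..1}" if "0 \<le> x" "y \<le> 1" for x y :: real using that by auto
  have gl: "g l < 0"
  proof -
    have "m * (a0 - l) \<le> g a0 - g l"
      by (rule derivative_lower_bound_imp_growth[OF der sub]) (use lu g'm in auto)
    moreover have "0 < m * (a0 - l)" using m lu by simp
    ultimately show ?thesis using a0(2) by linarith
  qed
  have gu: "0 < g u"
  proof -
    have "m * (u - a0) \<le> g u - g a0"
      by (rule derivative_lower_bound_imp_growth[OF der sub]) (use lu g'm in auto)
    moreover have "0 < m * (u - a0)" using m lu by simp
    ultimately show ?thesis using a0(2) by linarith
  qed
  \<comment> \<open>A nonnegative value here would force a second zero by the intermediate value
    theorem.\<close>
  have left: "g x < 0" if "x \<in> {0..l}" for x
  proof (rule ccontr)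
    assume "\<not> g x < 0"
    hence "\<exists>z. x \<le> z \<and> z \<le> l \<and> g z = 0"
      using that gl lu by (intro IVT2') (auto intro: continuous_on_subset[OF contg])
    then obtain z where "x \<le> z" "z \<le> l" "g z = 0" by blast
    thus False using a0(3)[of z] that lu by auto
  qed
  have right: "0 < g x" if "x \<in> {u..1}" for x
  proof (rule ccontr)
    assume "\<not> 0 < g x"
    hence "\<exists>z. u \<le> z \<and> z \<le> x \<and> g z = 0"
      using that gu lu by (intro IVT2') (auto intro: continuous_on_subset[OF contg])
    then obtain z where "u \<le> z" "z \<le> x" "g z = 0" by blast
    thus False using a0(3)[of z] that lu by auto
  qed
  obtain x1 where x1: "x1 \<in> {0..l}" "\<And>x. x \<in> {0..l} \<Longrightarrow> g x \<le> g x1"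
    using continuous_attains_sup[of "{0..l}" g] continuous_on_subset[OF contg, of "{0..l}"] lu by auto
  obtain x2 where x2: "x2 \<in> {u..1}" "\<And>x. x \<in> {u..1} \<Longrightarrow> g x2 \<le> g x"
    using continuous_attains_inf[of "{u..1}" g] continuous_on_subset[OF contg, of "{u..1}"] lu by auto
  define \<mu> where "\<mu> = min (- g x1) (g x2)"
  have \<mu>: "0 < \<mu>" using left[OF x1(1)] right[OF x2(1)] by (simp add: \<mu>_def)
  have left': "g x \<le> - \<mu>" if "x \<in> {0..l}" for x using x1(2)[OF that] by (simp add: \<mu>_def)
  have right': "\<mu> \<le> g x" if "x \<in> {u..1}" for x using x2(2)[OF that] by (simp add: \<mu>_def)
  define \<delta> where "\<delta> = min (m / 2) (\<mu> / 2)"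
  have \<delta>: "0 < \<delta>" "\<delta> \<le> m / 2" "\<delta> \<le> \<mu> / 2" using m \<mu> by (auto simp: \<delta>_def)
  show ?thesis
  proof (intro exI[of _ \<delta>] conjI allI impI \<delta>(1))
    fix G G' :: "real \<Rightarrow> real"
    assume near: "\<forall>x\<in>{0..1}. (G has_real_derivative G' x) (at x within {0..1}) \<and>
        \<bar>G x - g x\<bar> \<le> \<delta> \<and> \<bar>G' x - g' x\<bar> \<le> \<delta>"
    have derG: "\<And>x. x \<in> {0..1} \<Longrightarrow> (G has_real_derivative G' x) (at x within {0..1})"
      and G: "\<And>x. x \<in> {0..1} \<Longrightarrow> \<bar>G x - g x\<bar> \<le> \<delta>"
      and G': "\<And>x. x \<in> {0..1} \<Longrightarrow> \<bar>G' x - g' x\<bar> \<le> \<delta>"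
      using near by auto
    have contG: "continuous_on {0..1} G" using derG by (rule DERIV_continuous_on)
    have Gl: "G x \<le> - \<delta>" if "x \<in> {0..l}" for x
      using left'[OF that] G[of x] that lu \<delta> by auto
    have Gr: "\<delta> \<le> G x" if "x \<in> {u..1}" for x
      using right'[OF that] G[of x] that lu \<delta> by auto
    have Gm: "\<delta> \<le> G' x" if "x \<in> {l..u}" for x
      using g'm[OF that] G'[of x] that lu \<delta> by auto
    have "\<exists>a. l \<le> a \<and> a \<le> u \<and> G a = 0"
      using Gl[of l] Gr[of u] lu \<delta> by (intro IVT') (auto intro: continuous_on_subset[OF contG])
    then obtain a where a: "l \<le> a" "a \<le> u" "G a = 0" by blast
    have "\<delta> * \<bar>x - a\<bar> \<le> \<bar>G x\<bar>" if x: "x \<in> {0..1}" for x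
    proof -
      consider "x \<in> {0..l}" | "x \<in> {u..1}" | "x \<in> {l..a}" | "x \<in> {a..u}" using x a by force
      thus ?thesis
      proof cases
        case 3
        have "\<delta> * (a - x) \<le> G a - G x"
          by (rule derivative_lower_bound_imp_growth[OF derG sub]) (use 3 a lu Gm in auto)
        thus ?thesis using 3 a by simp
      next
        case 4
        have "\<delta> * (x - a) \<le> G x - G a"
          by (rule derivative_lower_bound_imp_growth[OF derG sub]) (use 4 a lu Gm in auto)
        thus ?thesis using 4 a by simp
      next
        \<comment> \<open>Away from the zero the constant bound already implies the linear one,
          since the interval has length 1.\<close>
        case 1
        have "\<bar>x - a\<bar> \<le> 1" using x a lu by auto
        hence "\<delta> * \<bar>x - a\<bar> \<le> \<delta>" using \<delta> by (simp add: mult_left_le)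
        thus ?thesis using Gl[OF 1] by linarith
      next
        case 2
        have "\<bar>x - a\<bar> \<le> 1" using x a lu by auto
        hence "\<delta> * \<bar>x - a\<bar> \<le> \<delta>" using \<delta> by (simp add: mult_left_le)
        thus ?thesis using Gr[OF 2] by linarith
      qed
    qed
    moreover have "0 < G' a" using Gm[of a] a \<delta> by auto
    ultimately show "\<exists>a\<in>{0<..<1}. G a = 0 \<and> 0 < G' a \<and> (\<forall>x\<in>{0..1}. \<delta> * \<bar>x - a\<bar> \<le> \<bar>G x\<bar>)"
      using a lu by (intro bexI[of _ a]) auto
  qed
qed

section \<open>A C1 bump with prescribed slope\<close>

text \<open>Squaring removes the kink of the truncation at 0: there the difference quotient is at
  most \<bar>h\<bar>. The bump built from it is therefore C1 with an explicit derivative.\<close>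

lemma has_real_derivative_max_0_square:
  "((\<lambda>s. (max 0 s)\<^sup>2) has_real_derivative 2 * max 0 s) (at (s::real))"
proof -
  consider "s < 0" | "s = 0" | "0 < s" by linarith
  thus ?thesis
  proof cases
    case 1
    have "((\<lambda>s::real. 0) has_real_derivative 0) (at s)" by simp
    thus ?thesis
      by (rule has_field_derivative_transform_within[where d = "-s", THEN DERIV_cong])
        (use 1 in \<open>auto simp: dist_real_def\<close>)
  next
    case 3
    have "((\<lambda>s::real. s\<^sup>2) has_real_derivative 2 * s) (at s)" by (auto intro!: derivative_eq_intros)
    thus ?thesis
      by (rule has_field_derivative_transform_within[where d = s, THEN DERIV_cong])
        (use 3 in \<open>auto simp: dist_real_def max_def\<close>)
  next
    case 2
    have "((\<lambda>h::real. (max 0 h)\<^sup>2 / h) \<longlongrightarrow> 0) (at 0)"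
      by (rule Lim_null_comparison[where g = "\<lambda>h. \<bar>h\<bar>"])
        (auto simp: max_def power2_eq_square intro!: tendsto_eq_intros)
    thus ?thesis using 2 by (simp add: DERIV_def)
  qed
qed

text \<open>The bump is a rescaled (1 - u^2)^2 with u = (x - a) / w, cut off outside \<bar>u\<bar>
  \<le> 1. Its slope before scaling is -4 u (1 - u^2) / w, so the height
  \<open>\<rho> * w / 4\<close> is what makes the slope bound \<open>\<rho>\<close>, independently
  of \<open>w\<close>.\<close>

lemma C1_bump:
  fixes a w \<rho> :: real
  assumes w: "0 < w" and \<rho>: "0 \<le> \<rho>"
  obtains \<phi> \<phi>' :: "real \<Rightarrow> real" where
    "\<And>x. (\<phi> has_real_derivative \<phi>' x) (at x)" "continuous_on UNIV \<phi>'" "\<And>x. \<bar>\<phi>' x\<bar> \<le> \<rho>"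
    "\<phi> a = \<rho> * w / 4" "\<And>x. \<bar>\<phi> x\<bar> \<le> \<rho> * w / 4 * indicator {a - w..a + w} x"
    "\<And>x. w \<le> \<bar>x - a\<bar> \<Longrightarrow> \<phi> x = 0"
proof -
  define v where "v x = max 0 (1 - ((x - a) / w)\<^sup>2)" for x
  define \<phi> where "\<phi> x = \<rho> * w / 4 * (v x)\<^sup>2" for x
  define \<phi>' where "\<phi>' x = - (\<rho> * ((x - a) / w) * v x)" for x
  have v01: "0 \<le> v x" "v x \<le> 1" for x by (auto simp: v_def)
  have v0: "v x = 0" if "w \<le> \<bar>x - a\<bar>" for x
  proof -
    have "1 \<le> \<bar>(x - a) / w\<bar>" using that w by (simp add: field_simps)
    hence "1 \<le> ((x - a) / w)\<^sup>2" by (metis one_power2 power2_abs power_mono zero_le_one)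
    thus ?thesis by (simp add: v_def)
  qed
  have d: "(\<phi> has_real_derivative \<phi>' x) (at x)" for x
  proof -
    have "((\<lambda>x. 1 - ((x - a) / w)\<^sup>2) has_real_derivative - (2 * ((x - a) / w) / w)) (at x)"
      using w by (auto intro!: derivative_eq_intros)
    from DERIV_chain2[OF has_real_derivative_max_0_square this]
    have "((\<lambda>x. (v x)\<^sup>2) has_real_derivative 2 * v x * - (2 * ((x - a) / w) / w)) (at x)"
      unfolding v_def .
    from DERIV_cmult[OF this, of "\<rho> * w / 4"] show ?thesis
      unfolding \<phi>_def \<phi>'_def using w by (rule_tac DERIV_cong) (auto simp: field_simps)
  qed
  have c: "continuous_on UNIV \<phi>'"
    unfolding \<phi>'_def v_def by (intro continuous_intros) (use w in auto)
  have b: "\<bar>\<phi>' x\<bar> \<le> \<rho>" for x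
  proof (cases "w \<le> \<bar>x - a\<bar>")
    case True
    thus ?thesis using v0 \<rho> by (simp add: \<phi>'_def)
  next
    case False
    hence "\<bar>(x - a) / w\<bar> \<le> 1" using w by (simp add: field_simps)
    hence "\<bar>(x - a) / w\<bar> * v x \<le> 1" using v01[of x] mult_mono[of "\<bar>(x - a) / w\<bar>" 1 "v x" 1] by simp
    hence "\<rho> * (\<bar>(x - a) / w\<bar> * v x) \<le> \<rho>" using \<rho> by (rule mult_left_le)
    moreover have "\<bar>\<phi>' x\<bar> = \<rho> * (\<bar>(x - a) / w\<bar> * v x)"
      using \<rho> v01[of x] unfolding \<phi>'_def by (simp only: abs_minus_cancel abs_mult abs_of_nonneg mult.assoc)
    ultimately show ?thesis by simp
  qed
  have i: "\<bar>\<phi> x\<bar> \<le> \<rho> * w / 4 * indicator {a - w..a + w} x" for x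
  proof (cases "w \<le> \<bar>x - a\<bar>")
    case True
    thus ?thesis using v0 \<rho> w by (simp add: \<phi>_def indicator_def)
  next
    case False
    hence "x \<in> {a - w..a + w}" by auto
    moreover have "\<rho> * w / 4 * (v x)\<^sup>2 \<le> \<rho> * w / 4 * 1"
      using \<rho> w v01[of x] by (intro mult_left_mono) (auto simp: power_le_one)
    ultimately show ?thesis using \<rho> w by (simp add: \<phi>_def)
  qed
  have "\<phi> a = \<rho> * w / 4" by (simp add: \<phi>_def v_def)
  moreover have "\<phi> x = 0" if "w \<le> \<bar>x - a\<bar>" for x using v0[OF that] by (simp add: \<phi>_def)
  ultimately show ?thesis using that d c b i by metis
qed

section \<open>Antiderivatives of bounded continuous functions\<close>

text \<open>The parameter is the derivative of the perturbation, taken from a type that is as a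
  whole a complete metric space under the sup norm, as Baire's theorem requires.\<close>

definition antiderivative :: "(real \<Rightarrow>\<^sub>C real) \<Rightarrow> real \<Rightarrow> real" where
  "antiderivative h x = integral {0..x} (apply_bcontfun h)"

lemma antiderivative_has_derivative:
  assumes "x \<in> {0..1}"
  shows "(antiderivative h has_real_derivative apply_bcontfun h x) (at x within {0..1})"
  using integral_has_vector_derivative[of 0 1 "apply_bcontfun h" x] assms
  unfolding antiderivative_def[abs_def] has_real_derivative_iff_has_vector_derivative by simp

text \<open>The interval of integration has length at most 1. Hence the one norm of the parameter
  controls both summands of the C1 distance.\<close>

lemma antiderivative_diff_le:
  assumes "x \<in> {0..1}"
  shows "\<bar>antiderivative h x - antiderivative k x\<bar> \<le> dist h k"
proof -
  have i: "apply_bcontfun f integrable_on {0..x}" for f :: "real \<Rightarrow>\<^sub>C real"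
    by (intro integrable_continuous_interval) simp
  have "((\<lambda>t. apply_bcontfun h t - apply_bcontfun k t) has_integral
      antiderivative h x - antiderivative k x) {0..x}"
    unfolding antiderivative_def by (intro has_integral_diff integrable_integral i)
  hence "norm (antiderivative h x - antiderivative k x) \<le> dist h k * measure lborel {0..x}"
    by (rule has_integral_bound_real[where S = "{}", rotated 2]) (auto simp: dist_real_def[symmetric] dist_bounded)
  also have "\<dots> \<le> dist h k * 1" using assms by (intro mult_left_mono) auto
  finally show ?thesis by simp
qed

lemma antiderivative_le:
  assumes "x \<in> {0..1}"
  shows "\<bar>antiderivative h x\<bar> \<le> norm h"
  using antiderivative_diff_le[OF assms, of h 0] by (simp add: antiderivative_def)

lemma antiderivative_add:
  assumes d: "\<And>x. (\<phi> has_real_derivative \<phi>' x) (at x)" and x: "0 \<le> x"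
    and k: "\<And>t. apply_bcontfun k t = apply_bcontfun h t + \<phi>' t"
  shows "antiderivative k x = antiderivative h x + (\<phi> x - \<phi> 0)"
proof -
  have "(\<phi>' has_integral (\<phi> x - \<phi> 0)) {0..x}"
    using x d by (intro fundamental_theorem_of_calculus)
      (auto simp: has_real_derivative_iff_has_vector_derivative[symmetric] intro: has_field_derivative_at_within)
  moreover have "(apply_bcontfun h has_integral antiderivative h x) {0..x}"
    unfolding antiderivative_def by (intro integrable_integral integrable_continuous_interval) simp
  ultimately have "(apply_bcontfun k has_integral antiderivative h x + (\<phi> x - \<phi> 0)) {0..x}"
    unfolding k by (metis has_integral_add)
  thus ?thesis unfolding antiderivative_def[of k] by (rule integral_unique)
qed

text \<open>The closed sets cover a ball rather than the whole space, so Baire's theorem is used in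
  the form that a countable union of closed sets with empty interior has empty interior.\<close>

lemma Baire_cball:
  fixes S :: "nat \<Rightarrow> 'a::complete_space set"
  assumes closed: "\<And>m. closed (S m)" and cover: "cball x \<delta> \<subseteq> (\<Union>m. S m)" and \<delta>: "0 < \<delta>"
  obtains m h \<rho> where "0 < \<rho>" "cball h \<rho> \<subseteq> S m"
proof -
  have "\<exists>m. interior (S m) \<noteq> {}"
  proof (rule ccontr)
    assume "\<not> ?thesis"
    hence "euclidean interior_of (\<Union>(range S)) = {}"
      using closed Met_TC.metric_Baire_category_alt[where 'a = 'a, of "range S"]
      by (auto simp: complete_UNIV)
    moreover have "ball x \<delta> \<subseteq> interior (\<Union>(range S))"
      using cover ball_subset_cball[of x \<delta>] by (intro interior_maximal) auto
    ultimately show False using \<delta> by (metis centre_in_ball empty_iff euclidean_interior_of subsetD)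
  qed
  then obtain m h where "h \<in> interior (S m)" by blast
  then obtain \<rho> where "0 < \<rho>" "cball h \<rho> \<subseteq> S m" by (auto simp: mem_interior_cball)
  thus ?thesis by (rule that)
qed

subsection \<open>The perturbed densities\<close>

lemma partial1_eqI:
  assumes "((\<lambda>t. f (t, y)) has_real_derivative d) (at x within {0..1})" "x \<in> {0..1}"
  shows "partial1 f (x, y) = d"
  using assms vector_derivative_within_closed_interval[of 0 1 x "\<lambda>t. f (t, y)" d]
  by (simp add: partial1_def has_real_derivative_iff_has_vector_derivative)

lemma C1_Omega_has_derivative:
  assumes "C1_Omega f" "y \<in> {-1, 1}" "x \<in> {0..1}"
  shows "((\<lambda>t. f (t, y)) has_real_derivative partial1 f (x, y)) (at x within {0..1})"
  using assms unfolding C1_Omega_def has_real_derivative_iff_has_vector_derivative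
  by (auto simp: differentiable_on_def partial1_def vector_derivative_works[symmetric])

lemma C1_OmegaI:
  assumes "\<And>x y. y \<in> {-1, 1} \<Longrightarrow> x \<in> {0..1} \<Longrightarrow>
      ((\<lambda>t. f (t, y)) has_real_derivative d x y) (at x within {0..1})"
    and "\<And>y. y \<in> {-1, 1} \<Longrightarrow> continuous_on {0..1} (\<lambda>x. d x y)"
  shows "C1_Omega f"
  unfolding C1_Omega_def
proof (intro ballI conjI)
  fix y :: int assume y: "y \<in> {-1, 1}"
  show "(\<lambda>t. f (t, y)) differentiable_on {0..1}"
    unfolding differentiable_on_def using assms(1)[OF y] real_differentiable_def by blast
  have "partial1 f (x, y) = d x y" if "x \<in> {0..1}" for x
    by (rule partial1_eqI[OF assms(1)[OF y that] that])
  thus "continuous_on {0..1} (\<lambda>x. partial1 f (x, y))"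
    using assms(2)[OF y] by (subst continuous_on_cong[OF refl]) auto
qed

section \<open>Integrals and strips under the dominating measure\<close>

lemma nn_integral_dom_measure:
  assumes g: "g \<in> borel_measurable dom_measure"
  shows "(\<integral>\<^sup>+\<omega>. g \<omega> \<partial>dom_measure)
    = (\<integral>\<^sup>+x. g (x, 1) + g (x, -1) \<partial>restrict_space lborel {0..1})"
proof -
  interpret S: finite_measure "count_space {-1, 1::int}"
    by (rule finite_measure_count_space) simp
  show ?thesis
    using g unfolding dom_measure_def
    by (subst S.nn_integral_fst[symmetric])
      (auto simp: nn_integral_count_space_finite add.commute intro!: nn_integral_cong)
qed

lemma emeasure_dom_measure_strip:
  assumes "E \<in> sets lborel"
  shows "(E \<inter> {0..1}) \<times> {-1, 1} \<in> sets dom_measure"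
    and "emeasure dom_measure ((E \<inter> {0..1}) \<times> {-1, 1}) = 2 * emeasure lborel (E \<inter> {0..1})"
proof -
  have E: "E \<inter> {0..1} \<in> sets (restrict_space lborel {0..1})"
    using assms by (auto simp: sets_restrict_space)
  interpret S: finite_measure "count_space {-1, 1::int}"
    by (rule finite_measure_count_space) simp
  show "(E \<inter> {0..1}) \<times> {-1, 1} \<in> sets dom_measure"
    unfolding dom_measure_def using E by (intro pair_measureI) auto
  have "emeasure dom_measure ((E \<inter> {0..1}) \<times> {-1, 1})
      = emeasure (restrict_space lborel {0..1}) (E \<inter> {0..1}) * emeasure (count_space {-1, 1::int}) {-1, 1}"
    unfolding dom_measure_def using E by (intro S.emeasure_pair_measure_Times) auto
  thus "emeasure dom_measure ((E \<inter> {0..1}) \<times> {-1, 1}) = 2 * emeasure lborel (E \<inter> {0..1})"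
    using assms by (simp add: emeasure_restrict_space mult.commute)
qed

lemma emeasure_dom_measure_space: "emeasure dom_measure (space dom_measure) = 2"
  using emeasure_dom_measure_strip(2)[of UNIV] by (simp add: space_dom_measure Omega_def)

lemma finite_measure_dom_measure: "finite_measure dom_measure"
  by (rule finite_measureI) (simp add: emeasure_dom_measure_space)

lemma measure_dom_measure_strip_le:
  assumes "u \<le> v"
  shows "measure dom_measure (({u..v} \<inter> {0..1}) \<times> {-1, 1}) \<le> 2 * (v - u)"
proof -
  have "emeasure lborel ({u..v} \<inter> {0..1}) \<le> emeasure lborel {u..v}"
    by (rule emeasure_mono) auto
  hence "emeasure dom_measure (({u..v} \<inter> {0..1}) \<times> {-1, 1}) \<le> 2 * ennreal (v - u)"
    using assms by (subst emeasure_dom_measure_strip(2)) (auto intro!: mult_left_mono)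
  also have "\<dots> = ennreal (2 * (v - u))" using assms by (subst ennreal_mult) auto
  finally show ?thesis using assms unfolding measure_def by (intro enn2real_leI) auto
qed

section \<open>Perturbed densities and the difference of their branches\<close>

definition perturbed :: "(real \<times> int \<Rightarrow> real) \<Rightarrow> (real \<Rightarrow>\<^sub>C real) \<Rightarrow> real \<times> int \<Rightarrow> real" where
  "perturbed f h = (\<lambda>(x, y). f (x, y) + real_of_int y * antiderivative h x)"

definition perturbed_measure ::
    "(real \<times> int \<Rightarrow> real) \<Rightarrow> (real \<Rightarrow>\<^sub>C real) \<Rightarrow> (real \<times> int) measure" where
  "perturbed_measure f h = density dom_measure (\<lambda>\<omega>. ennreal (perturbed f h \<omega>))"

text \<open>The branch for label 1 minus the branch for label -1 of \<open>perturbed f h\<close>;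
  its zeros are the crossings. The factor 2 appears because the branches move in opposite
  directions.\<close>

definition perturbed_diff :: "(real \<times> int \<Rightarrow> real) \<Rightarrow> (real \<Rightarrow>\<^sub>C real) \<Rightarrow> real \<Rightarrow> real" where
  "perturbed_diff f h x = f (x, 1) - f (x, -1) + 2 * antiderivative h x"

definition perturbed_diff' :: "(real \<times> int \<Rightarrow> real) \<Rightarrow> (real \<Rightarrow>\<^sub>C real) \<Rightarrow> real \<Rightarrow> real" where
  "perturbed_diff' f h x = partial1 f (x, 1) - partial1 f (x, -1) + 2 * apply_bcontfun h x"

lemma perturbed_has_derivative:
  assumes "C1_Omega f" "y \<in> {-1, 1}" "x \<in> {0..1}"
  shows "((\<lambda>t. perturbed f h (t, y)) has_real_derivative
    partial1 f (x, y) + real_of_int y * apply_bcontfun h x) (at x within {0..1})"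
  unfolding perturbed_def prod.case
  by (intro DERIV_add DERIV_cmult C1_Omega_has_derivative antiderivative_has_derivative assms)

lemma C1_Omega_perturbed:
  assumes "C1_Omega f"
  shows "C1_Omega (perturbed f h)"
  by (rule C1_OmegaI[OF perturbed_has_derivative[OF assms]])
    (use assms in \<open>auto simp: C1_Omega_def intro!: continuous_intros\<close>)

lemma perturbed_diff_has_derivative:
  assumes "C1_Omega f" "x \<in> {0..1}"
  shows "(perturbed_diff f h has_real_derivative perturbed_diff' f h x) (at x within {0..1})"
  unfolding perturbed_diff_def[abs_def] perturbed_diff'_def using assms
  by (intro DERIV_add DERIV_diff DERIV_cmult C1_Omega_has_derivative antiderivative_has_derivative) auto

text \<open>The two labels enter with opposite signs, so the density of the first coordinate is
  unchanged at every point.\<close>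

lemma perturbed_mass:
  assumes C1: "C1_Omega f" and nn: "\<And>\<omega>. \<omega> \<in> Omega \<Longrightarrow> 0 \<le> f \<omega>"
    "\<And>\<omega>. \<omega> \<in> Omega \<Longrightarrow> 0 \<le> perturbed f h \<omega>"
  shows "(\<integral>\<^sup>+\<omega>. perturbed f h \<omega> \<partial>dom_measure) = (\<integral>\<^sup>+\<omega>. f \<omega> \<partial>dom_measure)"
proof -
  have O: "(x, 1) \<in> Omega" "(x, -1) \<in> Omega" if "x \<in> {0..1}" for x
    using that by (auto simp: Omega_def)
  have "ennreal (perturbed f h (x, 1)) + ennreal (perturbed f h (x, -1)) = ennreal (f (x, 1)) + ennreal (f (x, -1))"
    if "x \<in> space (restrict_space lborel {0..1})" for x
  proof -
    have x: "x \<in> {0..1}" using that by (simp add: space_restrict_space)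
    have "perturbed f h (x, 1) + perturbed f h (x, -1) = f (x, 1) + f (x, -1)"
      by (simp add: perturbed_def)
    thus ?thesis using O[OF x] nn by (simp add: ennreal_plus[symmetric] del: ennreal_plus)
  qed
  moreover have "(\<lambda>\<omega>. ennreal (f \<omega>)) \<in> borel_measurable dom_measure"
    "(\<lambda>\<omega>. ennreal (perturbed f h \<omega>)) \<in> borel_measurable dom_measure"
    using C1_Omega_measurable[OF C1] C1_Omega_measurable[OF C1_Omega_perturbed[OF C1, of h]] by auto
  ultimately show ?thesis
    by (simp only: nn_integral_dom_measure cong: nn_integral_cong)
qed

text \<open>This collects what the two-point argument needs about a ball of parameters, detached
  from the topology on the measures. The factor 2 in \<open>f_ge\<close> leaves a density of at
  least \<open>p0\<close> after a perturbation of size at most \<open>\<delta>\<close>. In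
  \<open>zero\<close> a single \<open>\<kappa>\<close> serves all parameters.\<close>

locale perturbation_family =
  fixes f :: "real \<times> int \<Rightarrow> real" and p0 \<delta> \<kappa> :: real
  assumes C1: "C1_Omega f"
    and p0: "0 < p0" "\<delta> \<le> p0"
    and f_ge: "\<And>\<omega>. \<omega> \<in> Omega \<Longrightarrow> 2 * p0 \<le> f \<omega>"
    and mass: "(\<integral>\<^sup>+\<omega>. f \<omega> \<partial>dom_measure) = 1"
    and \<kappa>: "0 < \<kappa>"
    and zero: "\<And>h. norm h \<le> \<delta> \<Longrightarrow> \<exists>a\<in>{0<..<1}. perturbed_diff f h a = 0 \<and> 0 < perturbed_diff' f h a
        \<and> (\<forall>x\<in>{0..1}. \<kappa> * \<bar>x - a\<bar> \<le> \<bar>perturbed_diff f h x\<bar>)"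
begin

abbreviation "F h \<equiv> perturbed f h"
abbreviation "P h \<equiv> perturbed_measure f h"

lemma F_ge:
  assumes "norm h \<le> \<delta>" "\<omega> \<in> Omega"
  shows "p0 \<le> F h \<omega>"
proof -
  obtain x y where \<omega>: "\<omega> = (x, y)" "x \<in> {0..1}" "y \<in> {-1, 1}"
    using assms(2) by (auto simp: Omega_def)
  thus ?thesis
    using f_ge[OF assms(2)] antiderivative_le[of x h] p0 assms(1) by (auto simp: perturbed_def)
qed

lemma F_nonneg: "norm h \<le> \<delta> \<Longrightarrow> \<omega> \<in> Omega \<Longrightarrow> 0 \<le> F h \<omega>"
  using F_ge p0 by fastforce

lemma F_measurable: "F h \<in> borel_measurable dom_measure"
  by (rule C1_Omega_measurable[OF C1_Omega_perturbed[OF C1]])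

lemma prob_space_P:
  assumes "norm h \<le> \<delta>"
  shows "prob_space (P h)"
proof -
  have "0 \<le> f \<omega>" if "\<omega> \<in> Omega" for \<omega> using f_ge[OF that] p0 by linarith
  thus ?thesis
    unfolding perturbed_measure_def
    using F_measurable[of h] perturbed_mass[OF C1, of h] F_nonneg[OF assms] mass
    by (subst prob_space_density_iff) auto
qed

lemma C1_density_P: "norm h \<le> \<delta> \<Longrightarrow> C1_density (P h) (F h)"
  unfolding C1_density_def perturbed_measure_def using C1_Omega_perturbed[OF C1] F_nonneg by auto

lemma P_in_P_tilde: "norm h \<le> \<delta> \<Longrightarrow> P h \<in> P_tilde"
  unfolding P_tilde_def using prob_space_P C1_density_P by blast

lemma dens_P: "norm h \<le> \<delta> \<Longrightarrow> \<omega> \<in> Omega \<Longrightarrow> dens (P h) \<omega> = F h \<omega>"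
  using C1_density_unique[OF prob_space_P dens_C1[OF P_in_P_tilde] C1_density_P] .

lemma partial1_dens_P:
  assumes "norm h \<le> \<delta>" "y \<in> {-1, 1}" "x \<in> {0..1}"
  shows "partial1 (dens (P h)) (x, y) = partial1 f (x, y) + real_of_int y * apply_bcontfun h x"
proof (rule partial1_eqI)
  show "((\<lambda>t. dens (P h) (t, y)) has_real_derivative
      partial1 f (x, y) + real_of_int y * apply_bcontfun h x) (at x within {0..1})"
    \<comment> \<open>The chosen density is identified with \<open>F h\<close> on
      \<open>Omega\<close>, and the derivative within the unit interval sees only values
      there.\<close>
    by (rule has_field_derivative_transform_within[OF perturbed_has_derivative[OF C1 assms(2,3), of h], of 1])
      (use assms in \<open>auto simp: dens_P Omega_def\<close>)
qed fact

lemma is_crossing_P: "norm h \<le> \<delta> \<Longrightarrow> is_crossing (P h) x \<longleftrightarrow> x \<in> {0..1} \<and> perturbed_diff f h x = 0"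
  by (auto simp: is_crossing_def dens_P Omega_def perturbed_def perturbed_diff_def)

text \<open>The linear growth in \<open>zero\<close> leaves no zero besides \<open>a\<close>, so
  \<open>a\<close> is the crossing and the growth estimate carries over to it.\<close>

lemma crossing_P:
  assumes "norm h \<le> \<delta>"
  shows "crossing (P h) \<in> {0<..<1}" "perturbed_diff f h (crossing (P h)) = 0"
    "\<And>x. x \<in> {0..1} \<Longrightarrow> \<kappa> * \<bar>x - crossing (P h)\<bar> \<le> \<bar>perturbed_diff f h x\<bar>"
    "P h \<in> P_cal"
proof -
  obtain a where a: "a \<in> {0<..<1}" "perturbed_diff f h a = 0" "0 < perturbed_diff' f h a"
    "\<And>x. x \<in> {0..1} \<Longrightarrow> \<kappa> * \<bar>x - a\<bar> \<le> \<bar>perturbed_diff f h x\<bar>"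
    using zero[OF assms] by blast
  have cr: "is_crossing (P h) x \<longleftrightarrow> x = a" for x
  proof
    assume "is_crossing (P h) x"
    hence x: "x \<in> {0..1}" "perturbed_diff f h x = 0" using is_crossing_P[OF assms] by auto
    from a(4)[OF x(1)] x(2) \<kappa> show "x = a" by (simp add: mult_le_0_iff)
  qed (use a in \<open>auto simp: is_crossing_P[OF assms]\<close>)
  have ca: "crossing (P h) = a" unfolding crossing_def cr by simp
  show "crossing (P h) \<in> {0<..<1}" "perturbed_diff f h (crossing (P h)) = 0"
    "\<And>x. x \<in> {0..1} \<Longrightarrow> \<kappa> * \<bar>x - crossing (P h)\<bar> \<le> \<bar>perturbed_diff f h x\<bar>"
    unfolding ca using a by auto
  have "partial1 (dens (P h)) (a, 1) > partial1 (dens (P h)) (a, -1)"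
    using a(1,3) by (simp add: partial1_dens_P[OF assms] perturbed_diff'_def)
  thus "P h \<in> P_cal"
    unfolding P_cal_def using a(1) P_in_P_tilde[OF assms] by (auto simp: ca cr)
qed

text \<open>At the crossing of \<open>h\<close> the difference function of \<open>k\<close> is at
  most 2 times the distance of the parameters, and linear growth around its own zero turns this
  value into a distance of zeros.\<close>

lemma crossing_P_lipschitz:
  assumes "norm h \<le> \<delta>" "norm k \<le> \<delta>"
  shows "\<bar>crossing (P h) - crossing (P k)\<bar> \<le> 2 / \<kappa> * dist h k"
proof -
  let ?a = "crossing (P h)"
  have a: "?a \<in> {0..1}" using crossing_P(1)[OF assms(1)] by auto
  have "perturbed_diff f k ?a = 2 * (antiderivative k ?a - antiderivative h ?a)"
    using crossing_P(2)[OF assms(1)] by (simp add: perturbed_diff_def)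
  hence "\<bar>perturbed_diff f k ?a\<bar> \<le> 2 * dist h k"
    using antiderivative_diff_le[OF a, of k h] by (simp add: dist_commute)
  with crossing_P(3)[OF assms(2) a] show ?thesis using \<kappa> by (simp add: field_simps)
qed

text \<open>This is the counterpart of the growth estimate: an upper bound on the slope, uniform in
  \<open>h\<close>, makes a change in height displace the crossing by a comparable amount.\<close>

lemma perturbed_diff_lipschitz:
  obtains L where "0 < L" "\<And>h x y. norm h \<le> \<delta> \<Longrightarrow> x \<in> {0..1} \<Longrightarrow> y \<in> {0..1} \<Longrightarrow>
    \<bar>perturbed_diff f h x - perturbed_diff f h y\<bar> \<le> L * \<bar>x - y\<bar>"
proof -
  have "continuous_on {0..1} (\<lambda>x. partial1 f (x, 1) - partial1 f (x, -1))"
    using C1 by (intro continuous_intros) (auto simp: C1_Omega_def)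
  hence "bounded ((\<lambda>x. partial1 f (x, 1) - partial1 f (x, -1)) ` {0..1})"
    by (intro compact_imp_bounded compact_continuous_image) auto
  then obtain B where B: "0 < B" "\<And>x. x \<in> {0..1} \<Longrightarrow> \<bar>partial1 f (x, 1) - partial1 f (x, -1)\<bar> \<le> B"
    unfolding bounded_pos by auto
  show ?thesis
  \<comment> \<open>The absolute value keeps the constant positive, as the locale fixes no sign for
    \<open>\<delta>\<close>.\<close>
  proof (rule that[of "B + 2 * \<bar>\<delta>\<bar>"])
    show "0 < B + 2 * \<bar>\<delta>\<bar>" using B by simp
    fix h :: "real \<Rightarrow>\<^sub>C real" and x y :: real assume h: "norm h \<le> \<delta>" and xy: "x \<in> {0..1}" "y \<in> {0..1}"
    have b: "norm (perturbed_diff' f h z) \<le> B + 2 * \<bar>\<delta>\<bar>" if "z \<in> {0..1}" for z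
      using B(2)[OF that] norm_bounded[of h z] h by (simp add: perturbed_diff'_def)
    show "\<bar>perturbed_diff f h x - perturbed_diff f h y\<bar> \<le> (B + 2 * \<bar>\<delta>\<bar>) * \<bar>x - y\<bar>"
      using field_differentiable_bound[OF _ perturbed_diff_has_derivative[OF C1, of _ h] b xy] by simp
  qed
qed

text \<open>On both labels the densities differ by the same absolute value, namely that of the
  difference of the antiderivatives. It lives on a strip over the interval from \<open>u\<close> to
  \<open>v\<close>, whose mass counts both labels.\<close>

lemma P_PiM_diff_le:
  assumes h: "norm h \<le> \<delta>" and k: "norm k \<le> \<delta>" and uv: "u \<le> v"
    and s: "\<And>x. x \<in> {0..1} \<Longrightarrow> \<bar>antiderivative k x - antiderivative h x\<bar> \<le> s * indicator {u..v} x"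
    and A: "A \<in> sets (Pi\<^sub>M {..<n} (\<lambda>_. dom_measure))"
  shows "\<bar>measure (Pi\<^sub>M {..<n} (\<lambda>_. P k)) A - measure (Pi\<^sub>M {..<n} (\<lambda>_. P h)) A\<bar>
    \<le> sqrt ((1 + s\<^sup>2 / p0 * (2 * (v - u))) ^ n - 1)"
proof -
  let ?E = "({u..v} \<inter> {0..1}) \<times> {-1, 1::int}"
  have "\<bar>measure (Pi\<^sub>M {..<n} (\<lambda>_. P k)) A - measure (Pi\<^sub>M {..<n} (\<lambda>_. P h)) A\<bar>
      \<le> sqrt ((1 + s\<^sup>2 / p0 * measure dom_measure ?E) ^ card {..<n} - 1)"
    unfolding perturbed_measure_def
  proof (rule PiM_density_measure_diff_le[OF _ finite_measure_dom_measure])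
    show "prob_space (density dom_measure (\<lambda>\<omega>. ennreal (F h \<omega>)))"
      "prob_space (density dom_measure (\<lambda>\<omega>. ennreal (F k \<omega>)))"
      using prob_space_P h k unfolding perturbed_measure_def by auto
    show "?E \<in> sets dom_measure" by (rule emeasure_dom_measure_strip) simp
    fix \<omega> assume \<omega>: "\<omega> \<in> space dom_measure"
    then obtain x y where xy: "\<omega> = (x, y)" "x \<in> {0..1}" "y \<in> {-1, 1}"
      by (auto simp: Omega_def space_dom_measure)
    have "\<bar>F k \<omega> - F h \<omega>\<bar> = \<bar>antiderivative k x - antiderivative h x\<bar>"
      using xy by (auto simp: perturbed_def)
    also have "\<dots> \<le> s * indicator {u..v} x" by (rule s[OF xy(2)])
    also have "indicator {u..v} x = (indicator ?E \<omega> :: real)" using xy by (auto simp: indicator_def)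
    finally show "\<bar>F k \<omega> - F h \<omega>\<bar> \<le> s * indicator ?E \<omega>" .
  qed (use F_ge F_nonneg h k p0 A F_measurable in \<open>auto simp: space_dom_measure\<close>)
  also have "\<dots> \<le> sqrt ((1 + s\<^sup>2 / p0 * (2 * (v - u))) ^ n - 1)"
  proof -
    have "s\<^sup>2 / p0 * measure dom_measure ?E \<le> s\<^sup>2 / p0 * (2 * (v - u))"
      using p0 by (intro mult_left_mono measure_dom_measure_strip_le[OF uv]) auto
    moreover have "0 \<le> s\<^sup>2 / p0 * measure dom_measure ?E" using p0 by simp
    ultimately have "(1 + s\<^sup>2 / p0 * measure dom_measure ?E) ^ n \<le> (1 + s\<^sup>2 / p0 * (2 * (v - u))) ^ n"
      by (intro power_mono) linarith+
    thus ?thesis by simp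
  qed
  finally show ?thesis .
qed

lemma sets_P: "sets (P h) = sets dom_measure" and space_P: "space (P h) = space dom_measure"
  by (simp_all add: perturbed_measure_def)

lemma sets_PiM_P: "sets (Pi\<^sub>M I (\<lambda>_. P h)) = sets (Pi\<^sub>M I (\<lambda>_. dom_measure))"
  and space_PiM_P: "space (Pi\<^sub>M I (\<lambda>_. P h)) = space (Pi\<^sub>M I (\<lambda>_. dom_measure))"
  by (simp_all add: sets_P space_PiM space_P cong: sets_PiM_cong)

section \<open>Closedness of the parameter sets with small deviation probability\<close>

text \<open>The event is taken in the space of the dominating product, so that it can be measured
  under the law of any parameter. The level \<open>s\<close> is free because level 1 will be
  approached from above.\<close>

definition deviation ::
    "nat \<Rightarrow> ((nat \<Rightarrow> real \<times> int) \<Rightarrow> real) \<Rightarrow> real \<Rightarrow> (real \<Rightarrow>\<^sub>C real) \<Rightarrow> real \<Rightarrow> (nat \<Rightarrow> real \<times> int) set" where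
  "deviation n T b h s = {\<omega> \<in> space (Pi\<^sub>M {..<n} (\<lambda>_. dom_measure)). b * \<bar>T \<omega> - crossing (P h)\<bar> > s}"

abbreviation "prob n h A \<equiv> measure (Pi\<^sub>M {..<n} (\<lambda>_. P h)) A"

lemma deviation_sets:
  assumes "T \<in> borel_measurable (Pi\<^sub>M {..<n} (\<lambda>_. dom_measure))"
  shows "deviation n T b h s \<in> sets (Pi\<^sub>M {..<n} (\<lambda>_. dom_measure))"
  unfolding deviation_def using assms by measurable

text \<open>Here the strip is the whole unit interval. For fixed \<open>n\<close> the bound tends to
  0 with the distance, so probabilities depend continuously on the parameter, uniformly over
  events.\<close>

lemma prob_diff_le_dist:
  assumes "norm h \<le> \<delta>" "norm k \<le> \<delta>" "A \<in> sets (Pi\<^sub>M {..<n} (\<lambda>_. dom_measure))"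
  shows "\<bar>prob n k A - prob n h A\<bar> \<le> sqrt ((1 + (dist k h)\<^sup>2 / p0 * 2) ^ n - 1)"
  using P_PiM_diff_le[OF assms(1,2), of 0 1 "dist k h" A n] antiderivative_diff_le assms(3) by simp

text \<open>Both the law and the event vary with \<open>h\<close>. The slack \<open>s\<close>
  absorbs the shift of the crossing: the event of the limit at level 1 + s lies in the event of
  \<open>hs k\<close> at level 1 for large \<open>k\<close>, and continuity in total variation
  handles the law. Since the inequality in the event is strict, the event at level 1 is the
  increasing union of those at levels above 1.\<close>

lemma closed_deviation_prob_le:
  assumes T: "T \<in> borel_measurable (Pi\<^sub>M {..<n} (\<lambda>_. dom_measure))" and b: "0 < b"
  shows "closed {h \<in> cball 0 \<delta>. prob n h (deviation n T b h 1) \<le> c}"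
  unfolding closed_sequential_limits
proof (intro allI impI, elim conjE)
  fix hs h
  assume hs: "\<forall>k. hs k \<in> {h \<in> cball 0 \<delta>. prob n h (deviation n T b h 1) \<le> c}"
    and lim: "hs \<longlonglongrightarrow> h"
  have hsn: "norm (hs k) \<le> \<delta>" and hsc: "prob n (hs k) (deviation n T b (hs k) 1) \<le> c" for k
    using hs by auto
  have hn: "norm h \<le> \<delta>"
    by (rule LIMSEQ_le_const2[OF tendsto_norm[OF lim]]) (use hsn in auto)
  interpret D: prob_space "Pi\<^sub>M {..<n} (\<lambda>_. P h)"
    by (rule prob_space_PiM) (rule prob_space_P[OF hn])
  have dist0: "(\<lambda>k. dist h (hs k)) \<longlonglongrightarrow> 0"
    using tendsto_dist[OF tendsto_const lim, of h] by simp
  have step: "prob n h (deviation n T b h (1 + s)) \<le> c" if s: "0 < s" for s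
  proof -
    let ?B = "deviation n T b h (1 + s)"
    let ?e = "\<lambda>k. sqrt ((1 + (dist h (hs k))\<^sup>2 / p0 * 2) ^ n - 1)"
    have "(\<lambda>k. c + ?e k) \<longlonglongrightarrow> c + sqrt ((1 + 0\<^sup>2 / p0 * 2) ^ n - 1)"
      by (intro tendsto_intros dist0) (use p0 in auto)
    hence "(\<lambda>k. c + ?e k) \<longlonglongrightarrow> c" by simp
    moreover have "(\<lambda>k. b * (2 / \<kappa> * dist h (hs k))) \<longlonglongrightarrow> b * (2 / \<kappa> * 0)"
      by (intro tendsto_intros dist0)
    hence "eventually (\<lambda>k. b * (2 / \<kappa> * dist h (hs k)) < s) sequentially"
      using s by (intro order_tendstoD) auto
    hence "eventually (\<lambda>k. prob n h ?B \<le> c + ?e k) sequentially"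
    proof eventually_elim
      case (elim k)
      interpret K: prob_space "Pi\<^sub>M {..<n} (\<lambda>_. P (hs k))"
        by (rule prob_space_PiM) (rule prob_space_P[OF hsn])
      have close: "b * \<bar>crossing (P h) - crossing (P (hs k))\<bar> < s"
        using elim crossing_P_lipschitz[OF hn hsn[of k]] b by (meson le_less_trans mult_left_mono less_imp_le)
      have "?B \<subseteq> deviation n T b (hs k) 1"
      proof
        fix \<omega> assume \<omega>: "\<omega> \<in> ?B"
        have "b * \<bar>T \<omega> - crossing (P h)\<bar>
            \<le> b * (\<bar>T \<omega> - crossing (P (hs k))\<bar> + \<bar>crossing (P h) - crossing (P (hs k))\<bar>)"
          using b by (intro mult_left_mono) auto
        with \<omega> close show "\<omega> \<in> deviation n T b (hs k) 1"
          unfolding deviation_def distrib_left by auto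
      qed
      hence "prob n (hs k) ?B \<le> prob n (hs k) (deviation n T b (hs k) 1)"
        by (rule K.finite_measure_mono) (simp add: sets_PiM_P deviation_sets[OF T])
      moreover have "\<bar>prob n h ?B - prob n (hs k) ?B\<bar> \<le> ?e k"
        by (rule prob_diff_le_dist[OF hsn hn deviation_sets[OF T]])
      ultimately show ?case using hsc[of k] by linarith
    qed
    ultimately show ?thesis by (rule tendsto_lowerbound) simp
  qed
  let ?B = "\<lambda>j::nat. deviation n T b h (1 + 1 / real (Suc j))"
  have "(\<lambda>j. prob n h (?B j)) \<longlonglongrightarrow> prob n h (\<Union>j. ?B j)"
  proof (rule D.finite_Lim_measure_incseq)
    show "range ?B \<subseteq> sets (Pi\<^sub>M {..<n} (\<lambda>_. P h))"
      by (auto simp: sets_PiM_P deviation_sets[OF T])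
    show "incseq ?B"
    proof (rule incseq_SucI)
      fix j :: nat
      have "1 / real (Suc (Suc j)) \<le> 1 / real (Suc j)" by (simp add: field_simps)
      thus "?B j \<subseteq> ?B (Suc j)" by (auto simp: deviation_def)
    qed
  qed
  moreover have "(\<Union>j. ?B j) = deviation n T b h 1"
  proof (intro equalityI subsetI)
    fix \<omega> assume \<omega>: "\<omega> \<in> deviation n T b h 1"
    hence "0 < b * \<bar>T \<omega> - crossing (P h)\<bar> - 1" by (simp add: deviation_def)
    then obtain j where "1 / real (Suc j) < b * \<bar>T \<omega> - crossing (P h)\<bar> - 1"
      using nat_approx_posE by blast
    thus "\<omega> \<in> (\<Union>j. ?B j)" using \<omega> by (auto simp: deviation_def intro!: exI[of _ j])
  next
    fix \<omega> assume "\<omega> \<in> (\<Union>j. ?B j)"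
    then obtain j where "\<omega> \<in> ?B j" by blast
    moreover have "0 < 1 / real (Suc j)" by simp
    ultimately show "\<omega> \<in> deviation n T b h 1" unfolding deviation_def mem_Collect_eq by linarith
  qed
  ultimately have "prob n h (deviation n T b h 1) \<le> c"
    using step by (intro LIMSEQ_le_const2) auto
  thus "h \<in> {h \<in> cball 0 \<delta>. prob n h (deviation n T b h 1) \<le> c}"
    using hn by simp
qed

section \<open>The two-point argument\<close>

text \<open>The derivative of the bump is added to the parameter, so the antiderivative gains the
  bump itself. At the old crossing the difference function becomes \<open>\<rho> * w / 2\<close>,
  twice the height, while it vanishes at the new one; the Lipschitz constant \<open>L\<close> then
  bounds their distance from below.\<close>

lemma bump_perturbation:
  assumes h: "norm h \<le> \<delta>" and \<rho>: "0 < \<rho>" and ball: "\<And>k. dist h k \<le> \<rho> \<Longrightarrow> norm k \<le> \<delta>"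
    and w: "0 < w" "w \<le> crossing (P h)" and n: "real n * (\<rho>\<^sup>2 * w ^ 3 / (4 * p0)) \<le> 1 / 5"
    and L: "0 < L" "\<And>h x y. norm h \<le> \<delta> \<Longrightarrow> x \<in> {0..1} \<Longrightarrow> y \<in> {0..1} \<Longrightarrow>
      \<bar>perturbed_diff f h x - perturbed_diff f h y\<bar> \<le> L * \<bar>x - y\<bar>"
  obtains k where "dist h k \<le> \<rho>" "\<rho> * w / 2 \<le> L * \<bar>crossing (P h) - crossing (P k)\<bar>"
    "\<And>A. A \<in> sets (Pi\<^sub>M {..<n} (\<lambda>_. dom_measure)) \<Longrightarrow> \<bar>prob n k A - prob n h A\<bar> \<le> 1 / 2"
proof -
  define a where "a = crossing (P h)"
  have a: "a \<in> {0..1}" "perturbed_diff f h a = 0" using crossing_P[OF h] by (auto simp: a_def)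
  obtain \<phi> \<phi>' where \<phi>: "\<And>x. (\<phi> has_real_derivative \<phi>' x) (at x)" "continuous_on UNIV \<phi>'"
    "\<And>x. \<bar>\<phi>' x\<bar> \<le> \<rho>" "\<phi> a = \<rho> * w / 4"
    "\<And>x. \<bar>\<phi> x\<bar> \<le> \<rho> * w / 4 * indicator {a - w..a + w} x" "\<And>x. w \<le> \<bar>x - a\<bar> \<Longrightarrow> \<phi> x = 0"
    using C1_bump[OF w(1) less_imp_le[OF \<rho>], of a] by blast
  have "\<phi>' \<in> bcontfun"
    by (rule bcontfun_normI[of _ \<rho>]) (use \<phi>(2,3) in auto)
  then obtain d where d: "\<phi>' = apply_bcontfun d" by (rule bcontfunE)
  define k where "k = h + d"
  have k\<phi>: "apply_bcontfun k t = apply_bcontfun h t + \<phi>' t" for t by (simp add: k_def d)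
  have dist: "dist h k \<le> \<rho>"
    by (rule dist_bound) (use \<phi>(3) in \<open>simp add: k\<phi> dist_real_def\<close>)
  have kn: "norm k \<le> \<delta>" by (rule ball[OF dist])
  \<comment> \<open>Since \<open>w\<close> is at most the crossing, 0 lies outside the interior of
    the support, and the antiderivative gains no constant.\<close>
  have "\<phi> 0 = 0" using w(2) a by (intro \<phi>(6)) (auto simp: a_def)
  hence anti: "antiderivative k x = antiderivative h x + \<phi> x" if "0 \<le> x" for x
    using antiderivative_add[OF \<phi>(1) that k\<phi>] by simp
  show ?thesis
  proof (rule that[OF dist])
    have ck: "crossing (P k) \<in> {0..1}" "perturbed_diff f k (crossing (P k)) = 0"
      using crossing_P[OF kn] by auto
    have "perturbed_diff f k a = \<rho> * w / 2"
      using a \<phi>(4) anti[of a] by (simp add: perturbed_diff_def)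
    thus "\<rho> * w / 2 \<le> L * \<bar>crossing (P h) - crossing (P k)\<bar>"
      using L(2)[OF kn a(1) ck(1)] ck(2) by (simp add: a_def)
  next
    fix A assume A: "A \<in> sets (Pi\<^sub>M {..<n} (\<lambda>_. dom_measure))"
    \<comment> \<open>Squared height (\<open>\<rho> * w / 4\<close>)^2, divided by
      \<open>p0\<close>, times the mass bound 4 w of a strip of width 2 w.\<close>
    let ?c = "\<rho>\<^sup>2 * w ^ 3 / (4 * p0)"
    have "\<bar>prob n k A - prob n h A\<bar>
        \<le> sqrt ((1 + (\<rho> * w / 4)\<^sup>2 / p0 * (2 * ((a + w) - (a - w)))) ^ n - 1)"
      by (rule P_PiM_diff_le[OF h kn _ _ A]) (use w \<phi>(5) anti in auto)
    also have "(\<rho> * w / 4)\<^sup>2 / p0 * (2 * ((a + w) - (a - w))) = ?c"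
      by (simp add: power2_eq_square power3_eq_cube)
    finally have le: "\<bar>prob n k A - prob n h A\<bar> \<le> sqrt ((1 + ?c) ^ n - 1)" .
    \<comment> \<open>The threshold 1/5 is chosen so that exp (1/5) \<le> 5/4: the radicand is then
      at most 1/4 and its root at most 1/2.\<close>
    have "(1 + ?c) ^ n \<le> exp ?c ^ n"
      using w p0 by (intro power_mono exp_ge_add_one_self) auto
    also have "\<dots> = exp (real n * ?c)" by (simp only: exp_of_nat_mult)
    also have "\<dots> \<le> exp (1 / 5)" using n by simp
    also have "\<dots> \<le> 5 / 4"
    proof -
      have "4 / 5 \<le> exp (- (1 / 5) :: real)" using exp_ge_add_one_self[of "- (1 / 5) :: real"] by simp
      thus ?thesis by (simp add: exp_minus field_simps)
    qed
    finally have "sqrt ((1 + ?c) ^ n - 1) \<le> sqrt ((1 / 2)\<^sup>2)"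
      by (intro real_sqrt_le_mono) (simp add: power2_eq_square)
    thus "\<bar>prob n k A - prob n h A\<bar> \<le> 1 / 2" using le by simp
  qed
qed

lemma no_uniformly_good_estimator:
  fixes \<beta> :: "nat \<Rightarrow> real"
  assumes \<delta>: "0 < \<delta>" and c: "c < 1 / 4"
    and beta_pos: "\<And>n. n \<ge> 1 \<Longrightarrow> \<beta> n > 0"
    and beta_lim: "filterlim (\<lambda>n. real n powr (- 1 / 3) * \<beta> n) at_top sequentially"
    and T: "\<And>n. n \<ge> 1 \<Longrightarrow> T n \<in> borel_measurable (Pi\<^sub>M {..<n} (\<lambda>_. dom_measure))"
    and ev: "\<And>h. norm h \<le> \<delta> \<Longrightarrow>
      eventually (\<lambda>n. prob n h (deviation n (T n) (\<beta> n) h 1) \<le> c) sequentially"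
  shows False
proof -
  \<comment> \<open>Starting at \<open>Suc m\<close> excludes n = 0, where neither positivity of
    \<open>\<beta>\<close> nor measurability of the estimator is assumed.\<close>
  define S where "S m = (\<Inter>n\<in>{Suc m..}. {h \<in> cball 0 \<delta>. prob n h (deviation n (T n) (\<beta> n) h 1) \<le> c})" for m
  have cl: "closed (S m)" for m
    unfolding S_def by (intro closed_INT ballI closed_deviation_prob_le T beta_pos) auto
  have cover: "cball 0 \<delta> \<subseteq> (\<Union>m. S m)"
  proof
    fix h :: "real \<Rightarrow>\<^sub>C real" assume h: "h \<in> cball 0 \<delta>"
    then obtain m where "\<And>n. n \<ge> m \<Longrightarrow> prob n h (deviation n (T n) (\<beta> n) h 1) \<le> c"
      using ev[of h] by (auto simp: eventually_sequentially)
    hence "h \<in> S m" using h by (auto simp: S_def)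
    thus "h \<in> (\<Union>m. S m)" by blast
  qed
  obtain m h \<rho> where \<rho>: "0 < \<rho>" and ball: "cball h \<rho> \<subseteq> S m"
    by (rule Baire_cball[OF cl cover \<delta>])
  \<comment> \<open>The radius \<open>\<rho>\<close> and the threshold \<open>m\<close> are fixed
    before \<open>n\<close>, so the second measure may be chosen depending on
    \<open>n\<close>.\<close>
  have in_S: "norm k \<le> \<delta>" "\<And>n. n \<ge> Suc m \<Longrightarrow> prob n k (deviation n (T n) (\<beta> n) k 1) \<le> c"
    if "dist h k \<le> \<rho>" for k
    using subsetD[OF ball, of k] that by (auto simp: S_def)
  have h: "norm h \<le> \<delta>" using in_S(1)[of h] \<rho> by simp
  define a where "a = crossing (P h)"
  have a: "0 < a" using crossing_P(1)[OF h] by (simp add: a_def)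
  obtain L where L: "0 < L" "\<And>h x y. norm h \<le> \<delta> \<Longrightarrow> x \<in> {0..1} \<Longrightarrow> y \<in> {0..1} \<Longrightarrow>
      \<bar>perturbed_diff f h x - perturbed_diff f h y\<bar> \<le> L * \<bar>x - y\<bar>"
    using perturbed_diff_lipschitz by blast
  \<comment> \<open>With \<open>w\<close> = \<tau> n^(-1/3) one has n w^3 = \<tau>^3. The bound by 1
    gives \<tau>^3 \<le> \<tau>, and the other bound then yields the threshold 1/5 of
    \<open>bump_perturbation\<close>.\<close>
  define \<tau> where "\<tau> = min 1 (4 * p0 / (5 * \<rho>\<^sup>2))"
  have \<tau>: "0 < \<tau>" "\<tau> \<le> 1" "\<tau> \<le> 4 * p0 / (5 * \<rho>\<^sup>2)" using p0 \<rho> by (auto simp: \<tau>_def)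
  have "(\<lambda>n. \<tau> * real n powr (- 1 / 3)) \<longlonglongrightarrow> \<tau> * 0"
    by (intro tendsto_intros tendsto_neg_powr filterlim_real_sequentially) auto
  hence "eventually (\<lambda>n. \<tau> * real n powr (- 1 / 3) < a) sequentially"
    using a by (intro order_tendstoD) auto
  \<comment> \<open>The crossing moves by at least \<open>\<rho> * w / (2 * L)\<close>; this
    constant is what makes \<open>\<beta> n\<close> times that displacement exceed 2.\<close>
  moreover have "eventually (\<lambda>n. 4 * L / (\<rho> * \<tau>) < real n powr (- 1 / 3) * \<beta> n) sequentially"
    using beta_lim by (simp add: filterlim_at_top_dense)
  moreover have "eventually (\<lambda>n. n \<ge> Suc m) sequentially" by (rule eventually_ge_at_top)
  ultimately have "eventually (\<lambda>n. n \<ge> Suc m \<and> \<tau> * real n powr (- 1 / 3) < a \<and>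
      4 * L / (\<rho> * \<tau>) < real n powr (- 1 / 3) * \<beta> n) sequentially"
    by eventually_elim auto
  then obtain n where n: "n \<ge> Suc m" "\<tau> * real n powr (- 1 / 3) < a"
      "4 * L / (\<rho> * \<tau>) < real n powr (- 1 / 3) * \<beta> n"
    by (auto simp: eventually_sequentially)
  have n1: "n \<ge> 1" using n(1) by simp
  define w where "w = \<tau> * real n powr (- 1 / 3)"
  have w: "0 < w" "w \<le> crossing (P h)" using n(2) \<tau> n1 by (auto simp: w_def a_def)
  have "w ^ 3 = \<tau> ^ 3 * real n powr (- 1)"
    using n1 by (simp add: w_def power_mult_distrib powr_power)
  hence "real n * w ^ 3 = \<tau> ^ 3" using n1 by (simp add: powr_minus)
  also have "\<tau> ^ 3 \<le> \<tau>" using \<tau> power_decreasing[of 1 3 \<tau>] by simp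
  also have "\<dots> \<le> 4 * p0 / (5 * \<rho>\<^sup>2)" by (rule \<tau>)
  finally have "real n * (\<rho>\<^sup>2 * w ^ 3 / (4 * p0)) \<le> 1 / 5"
    using p0 \<rho> by (simp add: field_simps)
  from bump_perturbation[OF h \<rho> in_S(1) w this L] obtain k where k: "dist h k \<le> \<rho>"
    "\<rho> * w / 2 \<le> L * \<bar>crossing (P h) - crossing (P k)\<bar>"
    "\<And>A. A \<in> sets (Pi\<^sub>M {..<n} (\<lambda>_. dom_measure)) \<Longrightarrow> \<bar>prob n k A - prob n h A\<bar> \<le> 1 / 2"
    by blast
  have far: "2 < \<beta> n * \<bar>crossing (P h) - crossing (P k)\<bar>"
  proof -
    have "4 * L < \<rho> * w * \<beta> n" using n(3) \<rho> \<tau> by (simp add: w_def field_simps)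
    also have "\<dots> \<le> 2 * (L * \<bar>crossing (P h) - crossing (P k)\<bar>) * \<beta> n"
      using k(2) beta_pos[OF n1] by (intro mult_right_mono) auto
    finally have "L * 2 < L * (\<beta> n * \<bar>crossing (P h) - crossing (P k)\<bar>)" by (simp add: mult_ac)
    thus ?thesis using L(1) by simp
  qed
  let ?A = "\<lambda>h. deviation n (T n) (\<beta> n) h 1"
  interpret D: prob_space "Pi\<^sub>M {..<n} (\<lambda>_. P h)"
    by (rule prob_space_PiM) (rule prob_space_P[OF h])
  have sets: "?A h' \<in> sets (Pi\<^sub>M {..<n} (\<lambda>_. P h))" for h'
    by (simp add: sets_PiM_P deviation_sets[OF T[OF n1]])
  have "space (Pi\<^sub>M {..<n} (\<lambda>_. P h)) \<subseteq> ?A h \<union> ?A k"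
  proof
    fix \<omega> assume \<omega>: "\<omega> \<in> space (Pi\<^sub>M {..<n} (\<lambda>_. P h))"
    have "\<beta> n * \<bar>crossing (P h) - crossing (P k)\<bar>
        \<le> \<beta> n * (\<bar>T n \<omega> - crossing (P h)\<bar> + \<bar>T n \<omega> - crossing (P k)\<bar>)"
      using beta_pos[OF n1] by (intro mult_left_mono) auto
    with far \<omega> show "\<omega> \<in> ?A h \<union> ?A k"
      by (auto simp: deviation_def space_PiM_P distrib_left)
  qed
  hence "1 \<le> prob n h (?A h \<union> ?A k)"
    using D.finite_measure_mono[of "space (Pi\<^sub>M {..<n} (\<lambda>_. P h))"] sets D.prob_space by auto
  also have "\<dots> \<le> prob n h (?A h) + prob n h (?A k)"
    by (rule measure_Un_le[OF sets sets])
  also have "\<dots> \<le> c + (c + 1 / 2)"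
  proof -
    have "prob n h (?A h) \<le> c" using in_S(2)[of h n] n(1) \<rho> by simp
    moreover have "prob n k (?A k) \<le> c" by (rule in_S(2)[OF k(1) n(1)])
    moreover have "\<bar>prob n k (?A k) - prob n h (?A k)\<bar> \<le> 1 / 2"
      by (rule k(3)[OF deviation_sets[OF T[OF n1]]])
    ultimately show ?thesis by linarith
  qed
  finally show False using c by simp
qed

end

subsection \<open>Perturbation families inside an open set\<close>

lemma C1_Omega_bounded:
  assumes "C1_Omega f"
  obtains B where "0 < B" "\<And>\<omega>. \<omega> \<in> Omega \<Longrightarrow> \<bar>f \<omega>\<bar> \<le> B" "\<And>\<omega>. \<omega> \<in> Omega \<Longrightarrow> \<bar>partial1 f \<omega>\<bar> \<le> B"
proof -
  have "bdd_above ((\<lambda>\<omega>. \<bar>f \<omega>\<bar>) ` Omega)"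
    by (rule cont_bdd) (use C1_Omega_cont[OF assms] in auto)
  then obtain B1 where B1: "\<And>\<omega>. \<omega> \<in> Omega \<Longrightarrow> \<bar>f \<omega>\<bar> \<le> B1" by (auto simp: bdd_above_def)
  have "bdd_above ((\<lambda>\<omega>. \<bar>partial1 f \<omega>\<bar>) ` Omega)"
    by (rule cont_bdd) (use assms in \<open>auto simp: C1_Omega_def\<close>)
  then obtain B2 where B2: "\<And>\<omega>. \<omega> \<in> Omega \<Longrightarrow> \<bar>partial1 f \<omega>\<bar> \<le> B2" by (auto simp: bdd_above_def)
  show ?thesis
    by (rule that[of "max 1 (max B1 B2)"]) (use B1 B2 in \<open>auto simp: le_max_iff_disj\<close>)
qed

lemma P_dist_less:
  assumes "P \<in> P_tilde" "Q \<in> P_tilde" "0 < r"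
    and "\<And>\<omega>. \<omega> \<in> Omega \<Longrightarrow> \<bar>dens P \<omega> - dens Q \<omega>\<bar> \<le> r / 3"
    and "\<And>\<omega>. \<omega> \<in> Omega \<Longrightarrow> \<bar>partial1 (dens P) \<omega> - partial1 (dens Q) \<omega>\<bar> \<le> r / 3"
  shows "P_dist P Q < r"
proof -
  have ne: "Omega \<noteq> {}" by (auto simp: Omega_def)
  have "sup_norm (\<lambda>\<omega>. dens P \<omega> - dens Q \<omega>) \<le> r / 3"
    "sup_norm (\<lambda>\<omega>. partial1 (dens P) \<omega> - partial1 (dens Q) \<omega>) \<le> r / 3"
    unfolding sup_norm_def by (rule cSUP_least[OF ne assms(4)], assumption)
      (rule cSUP_least[OF ne assms(5)])
  thus ?thesis using assms(1-3) by (simp add: P_dist_def)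
qed

text \<open>Mixing with the uniform distribution bounds the density away from 0 without moving the
  crossing.\<close>

definition uniform_mixture :: "real \<Rightarrow> (real \<times> int \<Rightarrow> real) \<Rightarrow> real \<times> int \<Rightarrow> real" where
  "uniform_mixture \<epsilon> q \<omega> = (1 - \<epsilon>) * q \<omega> + \<epsilon> / 2"

lemma uniform_mixture_has_derivative:
  assumes "C1_Omega q" "y \<in> {-1, 1}" "x \<in> {0..1}"
  shows "((\<lambda>t. uniform_mixture \<epsilon> q (t, y)) has_real_derivative (1 - \<epsilon>) * partial1 q (x, y)) (at x within {0..1})"
  unfolding uniform_mixture_def
  by (rule DERIV_cong[OF DERIV_add[OF DERIV_cmult[OF C1_Omega_has_derivative[OF assms]] DERIV_const]]) simp

lemma C1_Omega_uniform_mixture: "C1_Omega q \<Longrightarrow> C1_Omega (uniform_mixture \<epsilon> q)"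
  by (rule C1_OmegaI[OF uniform_mixture_has_derivative])
    (auto simp: C1_Omega_def intro!: continuous_intros)

lemma partial1_uniform_mixture:
  "C1_Omega q \<Longrightarrow> y \<in> {-1, 1} \<Longrightarrow> x \<in> {0..1} \<Longrightarrow>
    partial1 (uniform_mixture \<epsilon> q) (x, y) = (1 - \<epsilon>) * partial1 q (x, y)"
  by (rule partial1_eqI[OF uniform_mixture_has_derivative])

text \<open>The dominating measure has total mass 2, one unit interval for each label, so the
  uniform density is the constant 1/2.\<close>

lemma uniform_mixture_mass:
  assumes C1: "C1_Omega q" and q: "\<And>\<omega>. \<omega> \<in> Omega \<Longrightarrow> 0 \<le> q \<omega>"
    and mass: "(\<integral>\<^sup>+\<omega>. q \<omega> \<partial>dom_measure) = 1" and \<epsilon>: "0 \<le> \<epsilon>" "\<epsilon> \<le> 1"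
  shows "(\<integral>\<^sup>+\<omega>. uniform_mixture \<epsilon> q \<omega> \<partial>dom_measure) = 1"
proof -
  note [measurable] = C1_Omega_measurable[OF C1]
  have "(\<integral>\<^sup>+\<omega>. uniform_mixture \<epsilon> q \<omega> \<partial>dom_measure)
      = (\<integral>\<^sup>+\<omega>. ennreal (1 - \<epsilon>) * ennreal (q \<omega>) + ennreal (\<epsilon> / 2) \<partial>dom_measure)"
    using \<epsilon> q unfolding uniform_mixture_def
    by (intro nn_integral_cong) (simp add: space_dom_measure ennreal_mult ennreal_plus)
  also have "\<dots> = ennreal (1 - \<epsilon>) * (\<integral>\<^sup>+\<omega>. ennreal (q \<omega>) \<partial>dom_measure) + ennreal (\<epsilon> / 2) * 2"
    by (subst nn_integral_add) (auto simp: nn_integral_cmult emeasure_dom_measure_space)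
  also have "\<dots> = ennreal (1 - \<epsilon>) + ennreal (\<epsilon> / 2 * 2)"
    using \<epsilon> by (subst ennreal_mult) (auto simp: mass)
  also have "\<dots> = ennreal ((1 - \<epsilon>) + \<epsilon>)"
    using \<epsilon> by (subst ennreal_plus) auto
  finally show ?thesis by simp
qed

text \<open>Mixing multiplies the difference of the branches by 1 - \<epsilon>, which preserves its
  only zero and the sign of its slope there. \<open>stable_zero\<close> therefore applies at
  parameter 0, and its constant serves both as the admissible C1 distance and as the growth rate of
  the whole family.\<close>

lemma P_cal_perturbation_family:
  assumes P: "P \<in> P_cal" and r: "0 < r"
  obtains f p0 \<delta> \<kappa> where "perturbation_family f p0 \<delta> \<kappa>" "0 < \<delta>"
    "\<And>h. norm h \<le> \<delta> \<Longrightarrow> P_dist P (perturbed_measure f h) < r"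
proof -
  have Pt: "P \<in> P_tilde" and ex1: "\<exists>!x. is_crossing P x" and cr: "crossing P \<in> {0<..<1}"
    and slope: "partial1 (dens P) (crossing P, 1) > partial1 (dens P) (crossing P, -1)"
    using P by (auto simp: P_cal_def)
  define q where "q = dens P"
  have q: "C1_density P q" unfolding q_def by (rule dens_C1[OF Pt])
  hence C1: "C1_Omega q" and q0: "\<And>\<omega>. \<omega> \<in> Omega \<Longrightarrow> 0 \<le> q \<omega>"
    and Pq: "P = density dom_measure (\<lambda>\<omega>. ennreal (q \<omega>))"
    by (auto simp: C1_density_def)
  have "prob_space P" using Pt by (simp add: P_tilde_def)
  hence mass: "(\<integral>\<^sup>+\<omega>. q \<omega> \<partial>dom_measure) = 1"
    using Pq C1_Omega_measurable[OF C1] prob_space_density_iff[of "\<lambda>\<omega>. ennreal (q \<omega>)"] by simp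
  define a where "a = crossing P"
  have "is_crossing P a" unfolding a_def crossing_def by (rule theI'[OF ex1])
  hence a0: "q (a, 1) = q (a, -1)" by (simp add: is_crossing_def q_def)
  have a1: "x = a" if "x \<in> {0..1}" "q (x, 1) = q (x, -1)" for x
    using ex1 \<open>is_crossing P a\<close> that by (auto simp: is_crossing_def q_def)
  obtain B where B: "0 < B" "\<And>\<omega>. \<omega> \<in> Omega \<Longrightarrow> \<bar>q \<omega>\<bar> \<le> B" "\<And>\<omega>. \<omega> \<in> Omega \<Longrightarrow> \<bar>partial1 q \<omega>\<bar> \<le> B"
    using C1_Omega_bounded[OF C1] by blast
  \<comment> \<open>Mixing changes the density by \<epsilon> (q - 1/2) and its derivative by
    \<epsilon> times that of \<open>q\<close>, each at most \<epsilon> (B + 1) \<le> r/8.\<close>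
  define \<epsilon> where "\<epsilon> = min (1 / 2) (r / (8 * (B + 1)))"
  have "\<epsilon> \<le> r / (8 * (B + 1))" by (simp add: \<epsilon>_def)
  hence "\<epsilon> * (8 * (B + 1)) \<le> r" using B(1) by (subst (asm) pos_le_divide_eq) auto
  moreover have "0 < \<epsilon>" "\<epsilon> \<le> 1 / 2" using r B(1) by (auto simp: \<epsilon>_def min_def)
  ultimately have \<epsilon>: "0 < \<epsilon>" "\<epsilon> \<le> 1 / 2" "\<epsilon> * (B + 1) \<le> r / 8" by (auto simp: algebra_simps)
  define f where "f = uniform_mixture \<epsilon> q"
  have C1f: "C1_Omega f" unfolding f_def by (rule C1_Omega_uniform_mixture[OF C1])
  have pf: "partial1 f (x, y) = (1 - \<epsilon>) * partial1 q (x, y)" if "y \<in> {-1, 1}" "x \<in> {0..1}" for x y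
    unfolding f_def by (rule partial1_uniform_mixture[OF C1 that])
  have d0: "(perturbed_diff f 0 has_real_derivative perturbed_diff' f 0 x) (at x within {0..1})"
    if "x \<in> {0..1}" for x
    by (rule perturbed_diff_has_derivative[OF C1f that])
  have g: "perturbed_diff f 0 x = (1 - \<epsilon>) * (q (x, 1) - q (x, -1))" for x
    by (simp add: perturbed_diff_def f_def uniform_mixture_def antiderivative_def algebra_simps)
  have g'_cont: "continuous_on {0..1} (perturbed_diff' f 0)"
    unfolding perturbed_diff'_def[abs_def] using C1f
    by (intro continuous_intros) (auto simp: C1_Omega_def)
  have a01: "a \<in> {0<..<1}" using cr by (simp add: a_def)
  have ga: "perturbed_diff f 0 a = 0" using a0 by (simp add: g)
  have ga_unique: "x = a" if "x \<in> {0..1}" "perturbed_diff f 0 x = 0" for x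
    using that a1 \<epsilon> by (simp add: g)
  have g'a: "0 < perturbed_diff' f 0 a"
    using slope cr \<epsilon> unfolding a_def[symmetric] q_def[symmetric] by (simp add: perturbed_diff'_def pf)
  obtain \<kappa> where \<kappa>: "0 < \<kappa>"
    "\<And>G G'. (\<forall>x\<in>{0..1}. (G has_real_derivative G' x) (at x within {0..1}) \<and>
        \<bar>G x - perturbed_diff f 0 x\<bar> \<le> \<kappa> \<and> \<bar>G' x - perturbed_diff' f 0 x\<bar> \<le> \<kappa>) \<Longrightarrow>
      \<exists>a\<in>{0<..<1}. G a = 0 \<and> 0 < G' a \<and> (\<forall>x\<in>{0..1}. \<kappa> * \<bar>x - a\<bar> \<le> \<bar>G x\<bar>)"
    using stable_zero[OF d0 g'_cont a01 ga ga_unique g'a] by metis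
  \<comment> \<open>The half of \<open>\<kappa>\<close> pays for the factor 2 in the difference of
    the branches, \<epsilon>/4 is the lower bound passed to the locale, and r/8 together with the
    r/8 from mixing stays below r/3.\<close>
  define \<delta> where "\<delta> = min (\<kappa> / 2) (min (\<epsilon> / 4) (r / 8))"
  have \<delta>: "0 < \<delta>" "\<delta> \<le> \<kappa> / 2" "\<delta> \<le> \<epsilon> / 4" "\<delta> \<le> r / 8"
    using \<kappa>(1) \<epsilon>(1) r by (auto simp: \<delta>_def)
  interpret perturbation_family f "\<epsilon> / 4" \<delta> \<kappa>
  proof
    fix \<omega> assume "\<omega> \<in> Omega"
    thus "2 * (\<epsilon> / 4) \<le> f \<omega>" using q0[of \<omega>] \<epsilon> by (simp add: f_def uniform_mixture_def)
  next
    show "(\<integral>\<^sup>+\<omega>. f \<omega> \<partial>dom_measure) = 1"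
      unfolding f_def by (rule uniform_mixture_mass[OF C1 q0 mass]) (use \<epsilon> in auto)
  next
    fix h :: "real \<Rightarrow>\<^sub>C real" assume h: "norm h \<le> \<delta>"
    show "\<exists>a\<in>{0<..<1}. perturbed_diff f h a = 0 \<and> 0 < perturbed_diff' f h a
        \<and> (\<forall>x\<in>{0..1}. \<kappa> * \<bar>x - a\<bar> \<le> \<bar>perturbed_diff f h x\<bar>)"
    proof (intro \<kappa>(2) ballI conjI)
      fix x :: real assume x: "x \<in> {0..1}"
      show "(perturbed_diff f h has_real_derivative perturbed_diff' f h x) (at x within {0..1})"
        by (rule perturbed_diff_has_derivative[OF C1f x])
      show "\<bar>perturbed_diff f h x - perturbed_diff f 0 x\<bar> \<le> \<kappa>"
        using antiderivative_le[OF x, of h] h \<delta> by (simp add: perturbed_diff_def antiderivative_def[of 0])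
      show "\<bar>perturbed_diff' f h x - perturbed_diff' f 0 x\<bar> \<le> \<kappa>"
        using norm_bounded[of h x] h \<delta> by (simp add: perturbed_diff'_def)
    qed
  qed (use C1f \<epsilon> \<delta> \<kappa> in auto)
  show ?thesis
  proof (rule that)
    show "perturbation_family f (\<epsilon> / 4) \<delta> \<kappa>" by (rule perturbation_family_axioms)
    show "0 < \<delta>" by (rule \<delta>)
    fix h :: "real \<Rightarrow>\<^sub>C real" assume h: "norm h \<le> \<delta>"
    have small: "\<bar>\<epsilon> * c + t\<bar> \<le> r / 3" if "\<bar>c\<bar> \<le> B + 1" "\<bar>t\<bar> \<le> norm h" for c t
    proof -
      have "\<bar>\<epsilon> * c\<bar> = \<epsilon> * \<bar>c\<bar>" using \<epsilon> by (simp add: abs_mult)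
      also have "\<dots> \<le> \<epsilon> * (B + 1)" using that(1) \<epsilon> by (intro mult_left_mono) auto
      also have "\<dots> \<le> r / 8" by (rule \<epsilon>)
      finally have "\<bar>\<epsilon> * c\<bar> \<le> r / 8" .
      thus ?thesis using that(2) h \<delta> r by linarith
    qed
    show "P_dist P (perturbed_measure f h) < r"
    proof (rule P_dist_less[OF Pt P_in_P_tilde[OF h] r])
      fix \<omega> assume \<omega>: "\<omega> \<in> Omega"
      then obtain x y where xy: "\<omega> = (x, y)" "x \<in> {0..1}" "y \<in> {-1, 1}" by (auto simp: Omega_def)
      have "dens P \<omega> - dens (perturbed_measure f h) \<omega>
          = \<epsilon> * (q \<omega> - 1 / 2) + - (real_of_int y * antiderivative h x)"
        unfolding dens_P[OF h \<omega>] q_def[symmetric]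
        by (simp add: perturbed_def f_def uniform_mixture_def xy(1) algebra_simps)
      thus "\<bar>dens P \<omega> - dens (perturbed_measure f h) \<omega>\<bar> \<le> r / 3"
        using B(2)[OF \<omega>] antiderivative_le[OF xy(2), of h] xy(3) by (simp only:) (rule small, auto)
      have "partial1 (dens P) \<omega> - partial1 (dens (perturbed_measure f h)) \<omega>
          = \<epsilon> * partial1 q \<omega> + - (real_of_int y * apply_bcontfun h x)"
        unfolding xy(1) partial1_dens_P[OF h xy(3,2)] pf[OF xy(3,2)] q_def[symmetric]
        by (simp add: algebra_simps)
      thus "\<bar>partial1 (dens P) \<omega> - partial1 (dens (perturbed_measure f h)) \<omega>\<bar> \<le> r / 3"
        using B(3)[OF \<omega>] norm_bounded[of h x] xy(3) by (simp only:) (rule small, auto)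
    qed
  qed
qed

theorem theorem1p2:
  fixes \<beta> :: "nat \<Rightarrow> real"
    and U :: "(real \<times> int) measure set"
    and a_hat :: "nat \<Rightarrow> (nat \<Rightarrow> real \<times> int) \<Rightarrow> real"
  assumes beta_pos: "\<And>n. n \<ge> 1 \<Longrightarrow> \<beta> n > 0"
    and beta_lim: "filterlim (\<lambda>n. real n powr (- 1 / 3) * \<beta> n) at_top sequentially"
    and U_open: "openin P_cal_topology U"
    and U_nonempty: "U \<noteq> {}"
    and estimator: "\<And>n. n \<ge> 1 \<Longrightarrow> a_hat n \<in> borel_measurable (Pi\<^sub>M {..<n} (\<lambda>_. Omega_borel))"
  shows "(SUP P\<in>U. limsup (\<lambda>n. ereal (measure (Pi\<^sub>M {..<n} (\<lambda>_. P))
            {\<omega> \<in> space (Pi\<^sub>M {..<n} (\<lambda>_. P)). \<beta> n * \<bar>a_hat n \<omega> - crossing P\<bar> > 1})))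
          \<ge> ereal (1 / 4)" (is "?S \<ge> _")
proof (rule ccontr)
  assume "\<not> ?thesis"
  hence "?S < ereal (1 / 4)" by simp
  \<comment> \<open>A real number strictly between turns a limsup below \<open>c\<close> into a
    bound by \<open>c\<close> that holds eventually, with the same \<open>c\<close> for every
    measure in \<open>U\<close>.\<close>
  then obtain c where c: "?S < ereal c" "ereal c < ereal (1 / 4)" using ereal_dense2 by blast
  interpret M: Metric_space P_tilde P_dist by (rule Metric_space_P_tilde)
  obtain V where V: "openin M.mtopology V" "U = V \<inter> P_cal"
    using U_open by (auto simp: P_cal_topology_def openin_subtopology)
  obtain P0 where P0: "P0 \<in> V" "P0 \<in> P_cal" using U_nonempty V(2) by blast
  obtain r where r: "0 < r" "M.mball P0 r \<subseteq> V"
    using V(1) P0(1) unfolding M.openin_mtopology by blast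
  obtain f p0 \<delta> \<kappa> where fam: "perturbation_family f p0 \<delta> \<kappa>" and \<delta>: "0 < \<delta>"
    and near: "\<And>h. norm h \<le> \<delta> \<Longrightarrow> P_dist P0 (perturbed_measure f h) < r"
    using P_cal_perturbation_family[OF P0(2) r(1)] by metis
  interpret perturbation_family f p0 \<delta> \<kappa> by (rule fam)
  show False
  proof (rule no_uniformly_good_estimator[OF \<delta> _ beta_pos beta_lim])
    show "c < 1 / 4" using c(2) by simp
    \<comment> \<open>Measurability depends on the sigma-algebra alone, and that of
      \<open>dom_measure\<close> is the Borel one on \<open>Omega\<close>.\<close>
    show "a_hat n \<in> borel_measurable (Pi\<^sub>M {..<n} (\<lambda>_. dom_measure))" if "n \<ge> 1" for n
      using estimator[OF that] by (simp add: sets_dom_measure cong: measurable_cong_sets sets_PiM_cong)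
    fix h :: "real \<Rightarrow>\<^sub>C real" assume h: "norm h \<le> \<delta>"
    have "P h \<in> M.mball P0 r"
      using near[OF h] P_in_P_tilde[OF h] P0(2) by (auto simp: P_cal_def)
    hence "P h \<in> U" using r(2) V(2) crossing_P(4)[OF h] by blast
    have "limsup (\<lambda>n. ereal (measure (Pi\<^sub>M {..<n} (\<lambda>_. P h))
        {\<omega> \<in> space (Pi\<^sub>M {..<n} (\<lambda>_. P h)). \<beta> n * \<bar>a_hat n \<omega> - crossing (P h)\<bar> > 1})) < ereal c"
      by (rule le_less_trans[OF SUP_upper[OF \<open>P h \<in> U\<close>] c(1)])
    from Limsup_lessD[OF this]
    show "eventually (\<lambda>n. prob n h (deviation n (a_hat n) (\<beta> n) h 1) \<le> c) sequentially"
      by eventually_elim (simp add: deviation_def space_PiM_P)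
  qed
qed

end
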